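(* For any $\lambda>0$, with $\lambda_m:=\lambda\sqrt{m}$ and $P_m(\lambda_m):=\sum_{i=1}^m\left(a_i+a_i^{\dagger}+\lambda_m a_i^0\right)$, the vacuum law of $\dfrac{P_m(\lambda_m)}{\sqrt{m}}$ converges weakly, as $m\to\infty$, to the distribution $$ \nu_\lambda=\frac{\lambda}{\sqrt{\lambda^2+2}}\,\delta_{\lambda-\sqrt{\lambda^2+2}}+\nu_\lambda^{\text{a.c.}}, $$ where $\nu_\lambda^{\text{a.c.}}$ is absolutely continuous w.r.t. the Lebesgue measure with density $$ \nu_\lambda^{\text{a.c.}}(dx)=\frac{\sqrt{2-(x-\lambda)^2}}{\pi(\lambda^2+2-(x-\lambda)^2)}\chi_{(\lambda-\sqrt2,\lambda+\sqrt2)}(x). $$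
   Context: Let $\mathcal{H}$ be a separable Hilbert space with a fixed orthonormal basis $(e_i)_{i\ge1}$. The monotone Fock space over $\mathcal{H}$ is the closed subspace of the full Fock space on $\mathcal{H}$ (with vacuum vector $\Omega=1\oplus0\oplus\cdots$) spanned by $\Omega$, $\mathcal{H}$ and all simple tensors $e_{i_1}\otimes e_{i_2}\otimes\cdots\otimes e_{i_k}$ with $i_1>i_2>\cdots>i_k$, $k\ge2$; write $e_{(i_1,\ldots,i_k)}$ for this tensor (and $e_{(i)}=e_i$). The monotone creation and annihilation operators $a_i^{\dagger}$, $a_i$ ($i\ge1$) are the mutually adjoint bounded operators on it determined by $a_i^{\dagger}\Omega=e_i$, $a_i\Omega=0$; $a_i^{\dagger}e_{(i_1,\ldots,i_k)}=e_{(i,i_1,\ldots,i_k)}$ if $i>i_1$ and $0$ otherwise; $a_ie_{(i_1,\ldots,i_k)}=e_{(i_2,\ldots,i_k)}$ if $i=i_1$ (this being $\Omega$ when $k=1$) and $0$ otherwise. The preservation operator is $a_i^0:=a_i^{\dagger}a_i$. The vacuum law of a bounded selfadjoint operator $T$ is the unique probability measure $\mu$ on $\mathbb{R}$ with $\int x^n\,\mu(dx)=\langle T^n\Omega,\Omega\rangle$ for all $n\ge0$. $\chi_S$ is the indicator function of $S$, and $\delta_x$ the Dirac measure at $x$. *)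

theory Defs
  imports "HOL-Probability.Probability"
begin

section \<open>Complex Hilbert spaces\<close>

text \<open>
  The real structure inherited from \<^class>\<open>real_inner\<close> and \<^class>\<open>complete_space\<close> is the
  underlying real Hilbert space, so that norm, topology and completeness are those of the library.
  The complex inner product is linear in its first argument.
\<close>

class complex_hilbert = real_inner + complete_space +
  fixes scaleC :: "complex \<Rightarrow> 'a \<Rightarrow> 'a" (infixr \<open>*\<^sub>C\<close> 75)
    and cinner :: "'a \<Rightarrow> 'a \<Rightarrow> complex"
  assumes scaleC_add_right: "c *\<^sub>C (x + y) = c *\<^sub>C x + c *\<^sub>C y"
    and scaleC_add_left: "(c + d) *\<^sub>C x = c *\<^sub>C x + d *\<^sub>C x"
    and scaleC_scaleC: "c *\<^sub>C d *\<^sub>C x = (c * d) *\<^sub>C x"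
    and scaleC_of_real: "complex_of_real r *\<^sub>C x = r *\<^sub>R x"
    and cinner_commute: "cinner x y = cnj (cinner y x)"
    and cinner_add_left: "cinner (x + y) z = cinner x z + cinner y z"
    and cinner_scaleC_left: "cinner (c *\<^sub>C x) y = c * cinner x y"
    and inner_eq_Re_cinner: "inner x y = Re (cinner x y)"

global_interpretation complex_vector:
  vector_space "scaleC :: complex \<Rightarrow> 'a \<Rightarrow> 'a::complex_hilbert"
proof
  show "1 *\<^sub>C x = x" for x :: 'a
    using scaleC_of_real[of 1 x] by simp
qed (simp_all add: scaleC_add_right scaleC_add_left scaleC_scaleC)

instantiation complex :: complex_hilbert
begin

definition scaleC_complex :: "complex \<Rightarrow> complex \<Rightarrow> complex"
  where "scaleC_complex = (*)"

definition cinner_complex :: "complex \<Rightarrow> complex \<Rightarrow> complex"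
  where "cinner_complex x y = x * cnj y"

instance
  by standard
    (simp_all add: scaleC_complex_def cinner_complex_def algebra_simps scaleR_conv_of_real
      inner_complex_def)

end

definition closed_cspan :: "'a::complex_hilbert set \<Rightarrow> 'a set"
  where "closed_cspan S = closure (complex_vector.span S)"

text \<open>The basis is indexed by the positive integers; the value at \<open>0\<close> is irrelevant.\<close>

definition orthonormal_basis :: "(nat \<Rightarrow> 'h::complex_hilbert) \<Rightarrow> bool"
  where "orthonormal_basis e \<longleftrightarrow>
    (\<forall>i\<ge>1. \<forall>j\<ge>1. cinner (e i) (e j) = (if i = j then 1 else 0)) \<and>
    closed_cspan (e ` {1..}) = UNIV"

definition bounded_clinear_on ::
    "'a::complex_hilbert set \<Rightarrow> ('a \<Rightarrow> 'a) \<Rightarrow> bool"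
  where "bounded_clinear_on V T \<longleftrightarrow>
    T ` V \<subseteq> V \<and>
    (\<forall>x\<in>V. \<forall>y\<in>V. T (x + y) = T x + T y) \<and>
    (\<forall>c. \<forall>x\<in>V. T (c *\<^sub>C x) = c *\<^sub>C T x) \<and>
    (\<exists>K. \<forall>x\<in>V. norm (T x) \<le> K * norm x)"


section \<open>Full and monotone Fock space\<close>

text \<open>
  The Hilbert space \<open>'f\<close> is the full Fock space, the Hilbert sum over \<open>n \<ge> 0\<close> of the \<open>n\<close>-fold
  Hilbert tensor powers of \<open>'h\<close>, where \<open>tensor [x\<^sub>1, \<dots>, x\<^sub>n]\<close> is the simple tensor
  \<open>x\<^sub>1 \<otimes> \<dots> \<otimes> x\<^sub>n\<close> of the \<open>n\<close>-th summand and \<open>tensor []\<close> is the vacuum vector.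
  The inner products of the simple tensors together with their totality determine the pair
  \<open>('f, tensor)\<close> up to a unique unitary isomorphism; multilinearity of \<open>tensor\<close> and orthogonality
  of the summands are consequences.
\<close>

definition full_fock_space :: "('h::complex_hilbert list \<Rightarrow> 'f::complex_hilbert) \<Rightarrow> bool"
  where "full_fock_space tensor \<longleftrightarrow>
    (\<forall>xs ys. cinner (tensor xs) (tensor ys) =
      (if length xs = length ys then (\<Prod>k<length xs. cinner (xs ! k) (ys ! k)) else 0)) \<and>
    closed_cspan (range tensor) = UNIV"

abbreviation vacuum :: "('h::complex_hilbert list \<Rightarrow> 'f::complex_hilbert) \<Rightarrow> 'f"
  where "vacuum tensor \<equiv> tensor []"

definition monotone_words :: "nat list set"
  where "monotone_words = {w. sorted_wrt (>) w \<and> (\<forall>i\<in>set w. 1 \<le> i)}"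

text \<open>The empty word gives the vacuum and the words of length one give the basis of \<open>'h\<close>.\<close>

definition basis_tensor ::
    "('h::complex_hilbert list \<Rightarrow> 'f::complex_hilbert) \<Rightarrow> (nat \<Rightarrow> 'h) \<Rightarrow> nat list \<Rightarrow> 'f"
  where "basis_tensor tensor e w = tensor (map e w)"

definition monotone_fock_space ::
    "('h::complex_hilbert list \<Rightarrow> 'f::complex_hilbert) \<Rightarrow> (nat \<Rightarrow> 'h) \<Rightarrow> 'f set"
  where "monotone_fock_space tensor e = closed_cspan (basis_tensor tensor e ` monotone_words)"

text \<open>
  \<open>a i\<close> and \<open>adag i\<close> are the monotone annihilation and creation operators, \<open>i \<ge> 1\<close>. They act on the
  monotone Fock space only; their values outside of it are unconstrained.
\<close>

definition monotone_operators ::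
    "('h::complex_hilbert list \<Rightarrow> 'f::complex_hilbert) \<Rightarrow> (nat \<Rightarrow> 'h) \<Rightarrow>
      (nat \<Rightarrow> 'f \<Rightarrow> 'f) \<Rightarrow> (nat \<Rightarrow> 'f \<Rightarrow> 'f) \<Rightarrow> bool"
  where "monotone_operators tensor e a adag \<longleftrightarrow>
    (\<forall>i\<ge>1.
      bounded_clinear_on (monotone_fock_space tensor e) (a i) \<and>
      bounded_clinear_on (monotone_fock_space tensor e) (adag i) \<and>
      (\<forall>x\<in>monotone_fock_space tensor e. \<forall>y\<in>monotone_fock_space tensor e.
        cinner (a i x) y = cinner x (adag i y)) \<and>
      adag i (vacuum tensor) = basis_tensor tensor e [i] \<and>
      a i (vacuum tensor) = 0 \<and>
      (\<forall>j w. j # w \<in> monotone_words \<longrightarrow>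
        adag i (basis_tensor tensor e (j # w)) =
          (if i > j then basis_tensor tensor e (i # j # w) else 0) \<and>
        a i (basis_tensor tensor e (j # w)) =
          (if i = j then basis_tensor tensor e w else 0)))"

definition preservation ::
    "(nat \<Rightarrow> 'f \<Rightarrow> 'f) \<Rightarrow> (nat \<Rightarrow> 'f \<Rightarrow> 'f) \<Rightarrow> nat \<Rightarrow> 'f \<Rightarrow> 'f"
  where "preservation a adag i = adag i \<circ> a i"

definition poisson_sum ::
    "(nat \<Rightarrow> 'f \<Rightarrow> 'f) \<Rightarrow> (nat \<Rightarrow> 'f \<Rightarrow> 'f) \<Rightarrow> nat \<Rightarrow> real \<Rightarrow> 'f \<Rightarrow> 'f::complex_hilbert"
  where "poisson_sum a adag m c x =
    (\<Sum>i=1..m. a i x + adag i x + c *\<^sub>R preservation a adag i x)"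


section \<open>Vacuum laws and the limit distribution\<close>

definition vacuum_law :: "'f::complex_hilbert \<Rightarrow> ('f \<Rightarrow> 'f) \<Rightarrow> real measure"
  where "vacuum_law \<Omega> T = (THE \<mu>. real_distribution \<mu> \<and>
    (\<forall>n. integrable \<mu> (\<lambda>x. x ^ n) \<and>
      complex_of_real (\<integral>x. x ^ n \<partial>\<mu>) = cinner ((T ^^ n) \<Omega>) \<Omega>))"

definition nu_ac :: "real \<Rightarrow> real measure"
  where "nu_ac l = density lborel (\<lambda>x. ennreal
    (sqrt (2 - (x - l)\<^sup>2) / (pi * (l\<^sup>2 + 2 - (x - l)\<^sup>2)) *
      indicator {l - sqrt 2<..<l + sqrt 2} x))"

definition nu :: "real \<Rightarrow> real measure"
  where "nu l = measure_of UNIV (sets borel) (\<lambda>A.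
    ennreal (l / sqrt (l\<^sup>2 + 2)) * emeasure (return borel (l - sqrt (l\<^sup>2 + 2))) A +
    emeasure (nu_ac l) A)"

lemma space_nu [simp]: "space (nu l) = UNIV"
  by (simp add: nu_def space_measure_of)

lemma sets_nu [simp]: "sets (nu l) = sets borel"
  using sigma_algebra.sets_measure_of_eq[OF sets.sigma_algebra_axioms[of borel]]
  by (simp add: nu_def)

text \<open>The set function in \<open>nu_def\<close> is countably additive, hence is the measure of \<open>nu\<close>.\<close>

lemma emeasure_nu:
  assumes A: "A \<in> sets borel"
  shows "emeasure (nu l) A =
    ennreal (l / sqrt (l\<^sup>2 + 2)) * emeasure (return borel (l - sqrt (l\<^sup>2 + 2))) A +
    emeasure (nu_ac l) A" (is "_ = ?\<mu> A")
proof (rule emeasure_measure_of[OF nu_def])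
  show "countably_additive (sets (nu l)) ?\<mu>"
  proof (rule countably_additiveI)
    fix B :: "nat \<Rightarrow> real set"
    assume B: "range B \<subseteq> sets (nu l)" "disjoint_family B"
    have 1: "(\<Sum>i. emeasure (return borel (l - sqrt (l\<^sup>2 + 2))) (B i)) =
        emeasure (return borel (l - sqrt (l\<^sup>2 + 2))) (\<Union>i. B i)"
      using B by (intro suminf_emeasure) simp_all
    have 2: "(\<Sum>i. emeasure (nu_ac l) (B i)) = emeasure (nu_ac l) (\<Union>i. B i)"
      using B by (intro suminf_emeasure) (simp_all add: nu_ac_def)
    show "(\<Sum>i. ?\<mu> (B i)) = ?\<mu> (\<Union>i. B i)"
      by (subst suminf_add[symmetric]) (simp_all add: 1 2)
  qed
qed (use A in \<open>auto simp: positive_def\<close>)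

end

theory Submission
  imports Defs
begin

text \<open>
  Write \<open>T\<^sub>k\<close> for the sum of the first \<open>k\<close> summands, scaled by \<open>s = 1 / \<surd>m\<close>, so that the operator of
  interest is \<open>T\<^sub>m\<close>. Let \<open>W\<^sub>k\<close> be spanned by the words with letters at most \<open>k\<close> (\<open>fock_upto\<close>).
  A decreasing word with letters at most \<open>k + 1\<close> either lies in \<open>W\<^sub>k\<close> or is \<open>k + 1\<close> followed by a word in \<open>W\<^sub>k\<close>, and for
  this decomposition \<open>T\<^bsub>k+1\<^esub>\<close> is the \<open>2 \<times> 2\<close> block operator with rows \<open>(T\<^sub>k, s)\<close> and \<open>(s, l)\<close>:
  the operators \<open>a\<^sub>i\<close>, \<open>a\<^sub>i\<^sup>\<dagger>\<close> with \<open>i \<le> k\<close> kill every word that starts with \<open>k + 1\<close>. All blocks commute,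
  hence the vacuum moments of \<open>T\<^bsub>k+1\<^esub>\<close> are obtained by averaging the moments of the numerical matrix
  with rows \<open>(w, s)\<close> and \<open>(s, l)\<close> over the vacuum law of \<open>T\<^sub>k\<close> in the variable \<open>w\<close>. So the vacuum
  laws form a Markov chain started at \<open>0\<close>: from \<open>w\<close> it jumps to one of the two eigenvalues of that
  matrix (\<open>chain_law\<close>, \<open>vacuum_moments\<close>). In particular the vacuum law exists and is finitely
  supported, and no spectral theorem beyond dimension two is involved. It is unique because moments
  that grow at most geometrically determine the characteristic function (\<open>char_tendsto_of_moments\<close>).

  In the centred variables \<open>v = w - l\<close> and \<open>u = x - l\<close> a step of the chain solves
  \<open>u\<^sup>2 = v u + s\<^sup>2\<close>. This gives \<open>u\<^sup>2 \<le> v\<^sup>2 + 2 s\<^sup>2\<close>, so that after at most \<open>m\<close> steps all laws live in the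
  interval of radius \<open>\<surd>(l\<^sup>2 + 2)\<close> around \<open>l\<close>. It also shows that the \<open>n\<close>-th centred moment of one
  step is \<open>v\<^sup>n + (n - 1) s\<^sup>2 v\<^bsup>n-2\<^esup> + O(s\<^sup>4)\<close> for \<open>n \<ge> 2\<close>. With \<open>s\<^sup>2 = 1 / m\<close> the moments of the chain therefore follow
  an Euler scheme with step \<open>1 / m\<close> for the triangular system \<open>N\<^sub>n' = (n - 1) N\<^bsub>n-2\<^esub>\<close>,
  \<open>N\<^sub>n(0) = (-l)\<^sup>n\<close>, and converge to its solution at time \<open>1\<close> (\<open>chain_moment_limit\<close>).

  The solution is explicit: \<open>N\<^bsub>n+2\<^esub>(t) = (l\<^sup>2 + 2t) N\<^sub>n(t) - c\<^sub>n t\<^bsup>n/2+1\<^esup>\<close>, where \<open>c\<^sub>n\<close> are the moments of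
  \<open>\<surd>(2 - u\<^sup>2) / \<pi>\<close>. At \<open>t = 1\<close> the centred moments of \<open>nu l\<close> obey the same recursion: multiplication
  by \<open>l\<^sup>2 + 2 - u\<^sup>2\<close> annihilates the atom and turns the density into \<open>\<surd>(2 - u\<^sup>2) / \<pi>\<close>
  (\<open>nu_central_moment\<close>). Convergence of moments on a common compact interval gives weak
  convergence by the continuity theorem of Levy.
\<close>


section \<open>Laws on a compact interval are governed by their moments\<close>

text \<open>
  Truncating at an even degree makes the remainder a multiple of an even moment, so that no
  absolute moments enter.
\<close>

lemma char_truncation_bound:
  assumes "real_distribution M" and "\<And>k. integrable M (\<lambda>x. x ^ k)"
    and "(\<integral>x. x ^ (2 * n) \<partial>M) \<le> R ^ (2 * n)"
  shows "cmod (char M t -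
      (\<Sum>k\<le>2 * n. ((\<i> * t) ^ k / fact k) * complex_of_real (\<integral>x. x ^ k \<partial>M)))
    \<le> 2 * ((\<bar>t\<bar> * R) ^ (2 * n) / fact (2 * n))"
proof -
  interpret real_distribution M by fact
  have "cmod (char M t -
      (\<Sum>k\<le>2 * n. ((\<i> * t) ^ k / fact k) * complex_of_real (\<integral>x. x ^ k \<partial>M)))
    \<le> (2 * \<bar>t\<bar> ^ (2 * n) / fact (2 * n)) * (\<integral>x. \<bar>x\<bar> ^ (2 * n) \<partial>M)"
    using assms(2) by (rule char_approx1)
  also have "\<dots> = (2 * \<bar>t\<bar> ^ (2 * n) / fact (2 * n)) * (\<integral>x. x ^ (2 * n) \<partial>M)"
    by (simp add: power_even_abs)
  also have "(2 * \<bar>t\<bar> ^ (2 * n) / fact (2 * n)) * (\<integral>x. x ^ (2 * n) \<partial>M)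
      \<le> (2 * \<bar>t\<bar> ^ (2 * n) / fact (2 * n)) * R ^ (2 * n)"
    using assms(3) by (intro mult_left_mono) auto
  finally show ?thesis by (simp add: power_mult_distrib)
qed

text \<open>
  The remainder bound is uniform in \<open>j\<close> because \<open>R\<close> is, so limits of finitely many moments decide
  the limit of the characteristic functions. Applied to a constant sequence, this also shows that
  such moments determine the law.
\<close>

lemma char_tendsto_of_moments:
  assumes M: "\<And>j. real_distribution (M j)" and N: "real_distribution N"
    and iM: "\<And>j n. integrable (M j) (\<lambda>x. x ^ n)" and iN: "\<And>n. integrable N (\<lambda>x. x ^ n)"
    and bound: "\<And>j n. (\<integral>x. x ^ (2 * n) \<partial>M j) \<le> R ^ (2 * n)"
    and lim: "\<And>n. (\<lambda>j. \<integral>x. x ^ n \<partial>M j) \<longlonglongrightarrow> (\<integral>x. x ^ n \<partial>N)"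
  shows "(\<lambda>j. char (M j) t) \<longlonglongrightarrow> char N t"
proof (rule tendstoI)
  fix \<epsilon> :: real assume "0 < \<epsilon>"
  have boundN: "(\<integral>x. x ^ (2 * n) \<partial>N) \<le> R ^ (2 * n)" for n
    using LIMSEQ_le_const2[OF lim] bound by blast
  have "(\<lambda>n. (\<bar>t\<bar> * R) ^ n / fact n) \<longlonglongrightarrow> 0"
    using summable_LIMSEQ_zero[OF summable_exp[of "\<bar>t\<bar> * R"]] by (simp add: field_simps)
  then have "(\<lambda>n. (\<bar>t\<bar> * R) ^ (2 * n) / fact (2 * n)) \<longlonglongrightarrow> 0"
    using LIMSEQ_subseq_LIMSEQ[of "\<lambda>n. (\<bar>t\<bar> * R) ^ n / fact n" 0 "\<lambda>n. 2 * n"]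
    by (simp add: o_def strict_mono_def)
  \<comment> \<open>The two truncation errors, for \<open>M j\<close> and \<open>N\<close>, are twice this quantity each, together less than \<open>\<epsilon> / 2\<close>.\<close>
  then have "\<forall>\<^sub>F n in sequentially. (\<bar>t\<bar> * R) ^ (2 * n) / fact (2 * n) < \<epsilon> / 8"
    using \<open>0 < \<epsilon>\<close> by (intro order_tendstoD(2)) auto
  then obtain n where n: "(\<bar>t\<bar> * R) ^ (2 * n) / fact (2 * n) < \<epsilon> / 8"
    by (auto simp: eventually_sequentially)
  define S where "S \<mu> = (\<Sum>k\<le>2 * n. ((\<i> * t) ^ k / fact k) *
    complex_of_real (\<integral>x. x ^ k \<partial>\<mu>))" for \<mu> :: "real measure"
  have "(\<lambda>j. S (M j)) \<longlonglongrightarrow> S N"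
    unfolding S_def by (intro tendsto_intros lim)
  then have "\<forall>\<^sub>F j in sequentially. dist (S (M j)) (S N) < \<epsilon> / 2"
    using \<open>0 < \<epsilon>\<close> by (intro tendstoD) auto
  then show "\<forall>\<^sub>F j in sequentially. dist (char (M j) t) (char N t) < \<epsilon>"
  proof eventually_elim
    case (elim j)
    have 1: "dist (char (M j) t) (S (M j)) \<le> 2 * ((\<bar>t\<bar> * R) ^ (2 * n) / fact (2 * n))"
      unfolding S_def dist_norm by (rule char_truncation_bound[OF M iM bound])
    have 2: "dist (char N t) (S N) \<le> 2 * ((\<bar>t\<bar> * R) ^ (2 * n) / fact (2 * n))"
      unfolding S_def dist_norm by (rule char_truncation_bound[OF N iN boundN])
    have "dist (char (M j) t) (char N t)
      \<le> dist (char (M j) t) (S (M j)) + dist (S (M j)) (S N) + dist (char N t) (S N)"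
      by (metis dist_commute dist_triangle dist_triangle_le add.commute add_left_mono)
    then show ?case using 1 2 n elim by linarith
  qed
qed

text \<open>
  The laws of interest live on an interval centred at \<open>c = l\<close>, where moments about \<open>l\<close> are simplest,
  while \<^const>\<open>vacuum_law\<close> and the characteristic function refer to moments about \<open>0\<close>. The binomial
  formula in the last claim passes from one to the other.
\<close>

lemma AE_bounded_moments:
  assumes "real_distribution M" and "AE x in M. \<bar>x - c\<bar> \<le> R"
  shows "integrable M (\<lambda>x. (x - c) ^ n)" and "integrable M (\<lambda>x. x ^ n)"
    and "(\<integral>x. x ^ (2 * n) \<partial>M) \<le> (R + \<bar>c\<bar>) ^ (2 * n)"
    and "(\<integral>x. x ^ n \<partial>M) = (\<Sum>k\<le>n. of_nat (n choose k) * c ^ (n - k) * (\<integral>x. (x - c) ^ k \<partial>M))"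
proof -
  interpret real_distribution M by fact
  show 1: "integrable M (\<lambda>x. (x - c) ^ n)" for n
    by (rule integrable_const_bound[where B = "R ^ n"])
       (use assms(2) in \<open>auto elim!: eventually_mono simp: power_abs intro!: power_mono\<close>)
  have bd: "AE x in M. \<bar>x\<bar> \<le> R + \<bar>c\<bar>"
    using assms(2) by eventually_elim linarith
  show 2: "integrable M (\<lambda>x. x ^ n)" for n
    by (rule integrable_const_bound[where B = "(R + \<bar>c\<bar>) ^ n"])
       (use bd in \<open>auto elim!: eventually_mono simp: power_abs intro!: power_mono\<close>)
  have "(\<integral>x. x ^ (2 * n) \<partial>M) \<le> (\<integral>x. (R + \<bar>c\<bar>) ^ (2 * n) \<partial>M)"
  proof (intro integral_mono_AE 2)
    show "AE x in M. x ^ (2 * n) \<le> (R + \<bar>c\<bar>) ^ (2 * n)"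
      using bd
    proof eventually_elim
      case (elim x)
      show ?case using power_mono[OF elim, of "2 * n"] by (simp add: power_even_abs)
    qed
  qed simp
  then show "(\<integral>x. x ^ (2 * n) \<partial>M) \<le> (R + \<bar>c\<bar>) ^ (2 * n)"
    using prob_space by simp
  have "x ^ n = (\<Sum>k\<le>n. of_nat (n choose k) * c ^ (n - k) * (x - c) ^ k)" for x :: real
    using binomial_ring[of "x - c" c n] by (simp add: ac_simps)
  then have "(\<integral>x. x ^ n \<partial>M) = (\<integral>x. (\<Sum>k\<le>n. of_nat (n choose k) * c ^ (n - k) * (x - c) ^ k) \<partial>M)"
    by simp
  also have "\<dots> = (\<Sum>k\<le>n. \<integral>x. of_nat (n choose k) * c ^ (n - k) * (x - c) ^ k \<partial>M)"
    by (intro Bochner_Integration.integral_sum integrable_mult_right 1)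
  finally show "(\<integral>x. x ^ n \<partial>M) = (\<Sum>k\<le>n. of_nat (n choose k) * c ^ (n - k) * (\<integral>x. (x - c) ^ k \<partial>M))"
    by simp
qed

lemma weak_conv_of_central_moments:
  assumes M: "\<And>j. real_distribution (M j)" and N: "real_distribution N"
    and bM: "\<And>j. AE x in M j. \<bar>x - c\<bar> \<le> R" and bN: "AE x in N. \<bar>x - c\<bar> \<le> R"
    and lim: "\<And>n. (\<lambda>j. \<integral>x. (x - c) ^ n \<partial>M j) \<longlonglongrightarrow> (\<integral>x. (x - c) ^ n \<partial>N)"
  shows "weak_conv_m M N"
proof (rule levy_continuity[OF M N])
  have "(\<lambda>j. \<integral>x. x ^ n \<partial>M j) \<longlonglongrightarrow> (\<integral>x. x ^ n \<partial>N)" for n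
    unfolding AE_bounded_moments(4)[OF M bM] AE_bounded_moments(4)[OF N bN]
    by (intro tendsto_intros lim)
  then show "(\<lambda>j. char (M j) t) \<longlonglongrightarrow> char N t" for t
    by (intro char_tendsto_of_moments[OF M N, where R = "R + \<bar>c\<bar>"] AE_bounded_moments(2)[OF M bM]
        AE_bounded_moments(2)[OF N bN] AE_bounded_moments(3)[OF M bM])
qed

text \<open>
  A competitor for the definite description is merely known to share all moments with \<open>M\<close>; it
  inherits their geometric growth, and that is enough for uniqueness.
\<close>

lemma vacuum_law_eqI:
  assumes M: "real_distribution M" and bM: "AE x in M. \<bar>x - c\<bar> \<le> R"
    and mom: "\<And>n. complex_of_real (\<integral>x. x ^ n \<partial>M) = cinner ((T ^^ n) \<Omega>) \<Omega>"
  shows "vacuum_law \<Omega> T = M"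
  unfolding vacuum_law_def
proof (rule the_equality)
  show "real_distribution M \<and> (\<forall>n. integrable M (\<lambda>x. x ^ n) \<and>
      complex_of_real (\<integral>x. x ^ n \<partial>M) = cinner ((T ^^ n) \<Omega>) \<Omega>)"
    using M AE_bounded_moments(2)[OF M bM] mom by blast
  fix N assume *: "real_distribution N \<and> (\<forall>n. integrable N (\<lambda>x. x ^ n) \<and>
      complex_of_real (\<integral>x. x ^ n \<partial>N) = cinner ((T ^^ n) \<Omega>) \<Omega>)"
  then have eq: "(\<integral>x. x ^ n \<partial>N) = (\<integral>x. x ^ n \<partial>M)" for n
    using mom[of n] by (metis of_real_eq_iff)
  have "(\<lambda>j::nat. char M t) \<longlonglongrightarrow> char N t" for t
    by (rule char_tendsto_of_moments[OF M])
       (use * AE_bounded_moments(2,3)[OF M bM] eq in auto)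
  then have "char N = char M"
    by (intro ext) (simp add: LIMSEQ_const_iff)
  then show "N = M"
    using * M by (intro Levy_uniqueness) auto
qed


section \<open>The Markov chain of vacuum laws\<close>

text \<open>
  These are the roots \<open>u\<close> of \<open>u\<^sup>2 = v u + s\<^sup>2\<close>, that is, the eigenvalues of the symmetric matrix
  with rows \<open>(v, s)\<close> and \<open>(s, 0)\<close>. The weight below is the squared first coordinate of the unit
  eigenvector for the positive root.
\<close>

definition root_plus :: "real \<Rightarrow> real \<Rightarrow> real"
  where "root_plus s v = (v + sqrt (v\<^sup>2 + 4 * s\<^sup>2)) / 2"

definition root_minus :: "real \<Rightarrow> real \<Rightarrow> real"
  where "root_minus s v = (v - sqrt (v\<^sup>2 + 4 * s\<^sup>2)) / 2"

definition weight_plus :: "real \<Rightarrow> real \<Rightarrow> real"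
  where "weight_plus s v = root_plus s v / (root_plus s v - root_minus s v)"

lemma root_eq:
  "(root_plus s v)\<^sup>2 = v * root_plus s v + s\<^sup>2" "(root_minus s v)\<^sup>2 = v * root_minus s v + s\<^sup>2"
proof -
  have "(sqrt (v\<^sup>2 + 4 * s\<^sup>2))\<^sup>2 = v\<^sup>2 + 4 * s\<^sup>2" by simp
  then show "(root_plus s v)\<^sup>2 = v * root_plus s v + s\<^sup>2"
    "(root_minus s v)\<^sup>2 = v * root_minus s v + s\<^sup>2"
    unfolding root_plus_def root_minus_def by (auto simp: power2_eq_square field_simps)
qed

lemma root_plus_minus_sum: "root_plus s v + root_minus s v = v"
  by (simp add: root_plus_def root_minus_def field_simps)

lemma root_signs:
  assumes "s > 0"
  shows "root_plus s v > 0" "root_minus s v < 0"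
proof -
  have "sqrt (v\<^sup>2) < sqrt (v\<^sup>2 + 4 * s\<^sup>2)"
    using assms by (intro real_sqrt_less_mono) simp
  then show "root_plus s v > 0" "root_minus s v < 0"
    unfolding root_plus_def root_minus_def by auto
qed

lemma weight_plus_bounds:
  assumes "s > 0"
  shows "0 \<le> weight_plus s v" "weight_plus s v \<le> 1"
  using root_signs[OF assms, of v] by (auto simp: weight_plus_def)

text \<open>
  Dividing by \<open>u\<close> gives \<open>v = u - s\<^sup>2 / u\<close>, and squaring this makes the error term \<open>(s\<^sup>2 / u)\<^sup>2\<close>
  favourable. Since the bound grows by exactly \<open>2 s\<^sup>2\<close> per step, \<open>1 / s\<^sup>2\<close> steps increase the square by
  at most \<open>2\<close>, independently of \<open>s\<close>.
\<close>

lemma root_square_le: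
  assumes "u\<^sup>2 = v * u + (s::real)\<^sup>2" "s > 0"
  shows "u\<^sup>2 \<le> v\<^sup>2 + 2 * s\<^sup>2"
proof -
  have "u \<noteq> 0" using assms by auto
  then have "v = u - s\<^sup>2 / u"
    using assms(1) by (simp add: power2_eq_square field_simps)
  then have "v\<^sup>2 = u\<^sup>2 - 2 * s\<^sup>2 + (s\<^sup>2 / u)\<^sup>2"
    using \<open>u \<noteq> 0\<close> by (simp add: power2_diff)
  then show ?thesis by simp
qed

text \<open>
  The spectral law, at the first unit vector, of the matrix with rows \<open>(w, s)\<close> and \<open>(s, l)\<close>.
\<close>

definition block_law :: "real \<Rightarrow> real \<Rightarrow> real \<Rightarrow> real pmf"
  where "block_law s l w = map_pmf
    (\<lambda>b. l + (if b then root_plus s (w - l) else root_minus s (w - l)))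
    (bernoulli_pmf (weight_plus s (w - l)))"

primrec chain_law :: "real \<Rightarrow> real \<Rightarrow> nat \<Rightarrow> real pmf"
  where
    "chain_law s l 0 = return_pmf 0"
  | "chain_law s l (Suc k) = bind_pmf (chain_law s l k) (block_law s l)"

lemma expectation_block_law:
  assumes "s > 0"
  shows "measure_pmf.expectation (block_law s l w) f =
    weight_plus s (w - l) * f (l + root_plus s (w - l)) +
    (1 - weight_plus s (w - l)) * (f (l + root_minus s (w - l)) :: real)"
  using weight_plus_bounds[OF assms] by (simp add: block_law_def)

lemma finite_block_law: "finite (set_pmf (block_law s l w))"
  by (simp add: block_law_def)

lemma finite_chain_law: "finite (set_pmf (chain_law s l k))"
  by (induction k) (auto simp: finite_block_law)

lemma integrable_chain_law [simp]:
  "integrable (measure_pmf (chain_law s l k)) (f :: real \<Rightarrow> real)"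
  by (rule integrable_measure_pmf_finite[OF finite_chain_law])

lemma expectation_chain_law_Suc:
  fixes f :: "real \<Rightarrow> real"
  shows "measure_pmf.expectation (chain_law s l (Suc k)) f =
    measure_pmf.expectation (chain_law s l k) (\<lambda>w. measure_pmf.expectation (block_law s l w) f)"
  by (simp add: pmf_expectation_bind[OF finite_chain_law finite_block_law order_refl]
      integral_measure_pmf[OF finite_chain_law])

lemma chain_law_support:
  assumes "s > 0" "x \<in> set_pmf (chain_law s l k)"
  shows "(x - l)\<^sup>2 \<le> l\<^sup>2 + 2 * real k * s\<^sup>2"
  using assms(2)
proof (induction k arbitrary: x)
  case (Suc k)
  then obtain w where w: "w \<in> set_pmf (chain_law s l k)" "x \<in> set_pmf (block_law s l w)"
    by auto
  then have "x - l = root_plus s (w - l) \<or> x - l = root_minus s (w - l)"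
    by (auto simp: block_law_def split: if_splits)
  then have "(x - l)\<^sup>2 = (w - l) * (x - l) + s\<^sup>2"
    using root_eq by metis
  then have "(x - l)\<^sup>2 \<le> (w - l)\<^sup>2 + 2 * s\<^sup>2"
    using assms(1) by (rule root_square_le)
  then show ?case using Suc.IH[OF w(1)] by (simp add: algebra_simps)
qed simp

text \<open>
  The first column of the \<open>n\<close>-th power of the matrix with rows \<open>(w, s)\<close> and \<open>(s, l)\<close>.
\<close>

fun block_top :: "real \<Rightarrow> real \<Rightarrow> real \<Rightarrow> nat \<Rightarrow> real"
  and block_bot :: "real \<Rightarrow> real \<Rightarrow> real \<Rightarrow> nat \<Rightarrow> real"
  where
    "block_top s l w 0 = 1"
  | "block_bot s l w 0 = 0"
  | "block_top s l w (Suc n) = w * block_top s l w n + s * block_bot s l w n"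
  | "block_bot s l w (Suc n) = s * block_top s l w n + l * block_bot s l w n"

text \<open>
  With \<open>p\<close>, \<open>q\<close> the two roots, both sequences of the recursion are combinations of the powers of
  the eigenvalues \<open>l + p\<close> and \<open>l + q\<close>; multiplying by \<open>d = p - q\<close> avoids fractions in the induction,
  which rests on \<open>p + q = w - l\<close> and \<open>p q = - s\<^sup>2\<close>.
\<close>

lemma block_law_moment:
  assumes "s > 0"
  shows "measure_pmf.expectation (block_law s l w) (\<lambda>x. x ^ n) = block_top s l w n"
proof -
  define v p q d where "v = w - l" and "p = root_plus s v" and "q = root_minus s v" and "d = p - q"
  have d: "d > 0" using root_signs[OF assms, of v] by (simp add: d_def p_def q_def)
  have sq: "p * p = v * p + s * s" "q * q = v * q + s * s"
    using root_eq[of s v] by (simp_all add: p_def q_def power2_eq_square)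
  have wl: "w = l + p + q"
    using root_plus_minus_sum[of s v] by (simp add: p_def q_def v_def)
  have pq: "p * q = - (s * s)"
  proof -
    have "p * (p - v) = s * s" using sq by (simp add: algebra_simps)
    moreover have "p - v = - q" using wl v_def by simp
    ultimately show ?thesis by simp
  qed
  have "block_top s l w n * d = p * (l + p) ^ n - q * (l + q) ^ n \<and>
    block_bot s l w n * d = s * ((l + p) ^ n - (l + q) ^ n)"
  proof (induction n)
    case 0
    then show ?case by (simp add: d_def)
  next
    case (Suc n)
    have "block_top s l w (Suc n) * d = (l + p + q) * (block_top s l w n * d) + s * (block_bot s l w n * d)"
      by (simp add: wl algebra_simps)
    also have "\<dots> = (l + p + q) * (p * (l + p) ^ n - q * (l + q) ^ n) + (s * s) * ((l + p) ^ n - (l + q) ^ n)"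
      using Suc by simp
    also have "s * s = - (p * q)" using pq by simp
    finally have 1: "block_top s l w (Suc n) * d = p * (l + p) ^ Suc n - q * (l + q) ^ Suc n"
      by (simp add: algebra_simps)
    have "block_bot s l w (Suc n) * d = s * (block_top s l w n * d) + l * (block_bot s l w n * d)"
      by (simp add: algebra_simps)
    also have "\<dots> = s * (p * (l + p) ^ n - q * (l + q) ^ n) + l * (s * ((l + p) ^ n - (l + q) ^ n))"
      using Suc by simp
    also have "\<dots> = s * ((l + p) ^ Suc n - (l + q) ^ Suc n)"
      by (simp add: algebra_simps)
    finally show ?case using 1 by simp
  qed
  then have "block_top s l w n = (p * (l + p) ^ n - q * (l + q) ^ n) / d"
    using d by (simp add: eq_divide_eq)
  moreover have "1 - p / d = - q / d"
    using d by (simp add: d_def field_simps)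
  ultimately have "block_top s l w n = p / d * (l + p) ^ n + (1 - p / d) * (l + q) ^ n"
    by (simp add: diff_divide_distrib)
  then show ?thesis
    by (simp add: expectation_block_law[OF assms] weight_plus_def p_def q_def v_def d_def)
qed


section \<open>Vacuum moments of the partial sums\<close>

locale monotone_fock =
  fixes e :: "nat \<Rightarrow> 'h::complex_hilbert"
    and tensor :: "'h list \<Rightarrow> 'f::complex_hilbert"
    and a adag :: "nat \<Rightarrow> 'f \<Rightarrow> 'f"
  assumes fock: "full_fock_space tensor"
    and ops: "monotone_operators tensor e a adag"
begin

abbreviation F :: "'f set" where "F \<equiv> monotone_fock_space tensor e"
abbreviation b :: "nat list \<Rightarrow> 'f" where "b \<equiv> basis_tensor tensor e"
abbreviation \<Omega> :: 'f where "\<Omega> \<equiv> tensor []"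

text \<open>
  All vectors that occur are finite real combinations of basis words, so real spans suffice; the
  closed complex span \<open>F\<close> is only the domain on which the operators are known to be linear.
\<close>

definition words_upto :: "nat \<Rightarrow> nat list set"
  where "words_upto k = {w \<in> monotone_words. \<forall>i\<in>set w. i \<le> k}"

definition fock_upto :: "nat \<Rightarrow> 'f set"
  where "fock_upto k = span (b ` words_upto k)"

definition real_linear :: "('f \<Rightarrow> 'f) \<Rightarrow> bool"
  where "real_linear f \<longleftrightarrow>
    (\<forall>x\<in>F. \<forall>y\<in>F. f (x + y) = f x + f y) \<and> (\<forall>r. \<forall>x\<in>F. f (r *\<^sub>R x) = r *\<^sub>R f x)"

lemma complex_span_subset_F: "complex_vector.span (b ` monotone_words) \<subseteq> F"
  unfolding monotone_fock_space_def closed_cspan_def by (rule closure_subset)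

lemma fock_upto_subset_F: "fock_upto k \<subseteq> F"
proof -
  have "subspace (complex_vector.span (b ` monotone_words))"
    unfolding subspace_def
    by (auto simp: complex_vector.span_zero complex_vector.span_add
        complex_vector.span_scale simp flip: scaleC_of_real)
  moreover have "b ` words_upto k \<subseteq> complex_vector.span (b ` monotone_words)"
    by (auto simp: words_upto_def intro: complex_vector.span_base)
  ultimately have "fock_upto k \<subseteq> complex_vector.span (b ` monotone_words)"
    unfolding fock_upto_def by (intro span_minimal)
  then show ?thesis using complex_span_subset_F by blast
qed

lemma fock_upto_F: "x \<in> fock_upto k \<Longrightarrow> x \<in> F"
  using fock_upto_subset_F by blast

lemma fock_upto_word: "w \<in> words_upto k \<Longrightarrow> b w \<in> fock_upto k"
  unfolding fock_upto_def by (intro span_base imageI)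

lemma fock_upto_closed [intro]:
  "0 \<in> fock_upto k"
  "x \<in> fock_upto k \<Longrightarrow> y \<in> fock_upto k \<Longrightarrow> x + y \<in> fock_upto k"
  "x \<in> fock_upto k \<Longrightarrow> r *\<^sub>R x \<in> fock_upto k"
  unfolding fock_upto_def by (auto intro: span_zero span_add span_scale)

lemma vacuum_in_fock_upto: "\<Omega> \<in> fock_upto k"
  using fock_upto_word[of "[]" k] by (simp add: words_upto_def monotone_words_def basis_tensor_def)

lemma fock_upto_induct [consumes 1, case_names zero step]:
  assumes "x \<in> fock_upto k" and "P 0"
    and "\<And>r w y. w \<in> words_upto k \<Longrightarrow> y \<in> fock_upto k \<Longrightarrow> P y \<Longrightarrow> P (r *\<^sub>R b w + y)"
  shows "P x"
proof -
  have "x \<in> fock_upto k \<and> P x"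
    using assms(1) unfolding fock_upto_def
  proof (induction rule: span_induct_alt)
    case base
    then show ?case using assms(2) span_zero by blast
  next
    case (step r x y)
    then obtain w where w: "w \<in> words_upto k" "x = b w" by blast
    have y: "y \<in> fock_upto k" "P y" using step.IH by (simp_all add: fock_upto_def)
    have "r *\<^sub>R x + y \<in> span (b ` words_upto k)"
      using w(1) step.IH unfolding w(2) by (intro span_add span_scale span_base[OF imageI]) auto
    then show ?case using assms(3)[OF w(1) y] w(2) by simp
  qed
  then show ?thesis by blast
qed

lemma real_linear_zero:
  assumes "real_linear f"
  shows "f 0 = 0"
proof -
  have "f (0 *\<^sub>R 0) = 0 *\<^sub>R f 0"
    using assms fock_upto_F[OF fock_upto_closed(1)] unfolding real_linear_def by blast
  then show ?thesis by simp
qed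

lemma real_linear_upto:
  assumes "real_linear f" "x \<in> fock_upto k" "y \<in> fock_upto k"
  shows "f (x + y) = f x + f y" "f (r *\<^sub>R x) = r *\<^sub>R f x"
  using assms fock_upto_F unfolding real_linear_def by blast+

lemma real_linear_eqI:
  assumes "real_linear f" "real_linear g" "x \<in> fock_upto k"
    and "\<And>w. w \<in> words_upto k \<Longrightarrow> f (b w) = g (b w)"
  shows "f x = g x"
  using assms(3)
proof (induction rule: fock_upto_induct)
  case (step r w y)
  then have "r *\<^sub>R b w \<in> fock_upto k" "b w \<in> fock_upto k" by (simp_all add: fock_upto_word fock_upto_closed(3))
  then show ?case
    using step by (simp add: real_linear_upto[OF assms(1)] real_linear_upto[OF assms(2)] assms(4))
qed (simp add: assms(1,2) real_linear_zero)

lemma real_linear_memI: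
  assumes "real_linear f" "x \<in> fock_upto k"
    and "\<And>w. w \<in> words_upto k \<Longrightarrow> f (b w) \<in> fock_upto j"
  shows "f x \<in> fock_upto j"
  using assms(2)
proof (induction rule: fock_upto_induct)
  case (step r w y)
  have bw: "b w \<in> fock_upto k" "r *\<^sub>R b w \<in> fock_upto k" using step by (simp_all add: fock_upto_word fock_upto_closed(3))
  have "f (r *\<^sub>R b w + y) = r *\<^sub>R f (b w) + f y"
    using real_linear_upto[OF assms(1)] bw step(2) by metis
  then show ?case
    using step assms(3) by (simp add: fock_upto_closed(2,3))
qed (auto simp: assms(1) real_linear_zero)

lemma real_linear_const_zero: "real_linear (\<lambda>_. 0)"
  and real_linear_id: "real_linear (\<lambda>x. x)"
  by (simp_all add: real_linear_def)

lemma real_linear_compose: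
  "real_linear f \<Longrightarrow> real_linear g \<Longrightarrow> g ` F \<subseteq> F \<Longrightarrow> real_linear (\<lambda>x. f (g x))"
  unfolding real_linear_def by (simp add: image_subset_iff)

lemma real_linear_bounded_clinear: "bounded_clinear_on F f \<Longrightarrow> real_linear f"
  unfolding bounded_clinear_on_def real_linear_def by (simp flip: scaleC_of_real)

lemma real_linear_ops: "i \<ge> 1 \<Longrightarrow> real_linear (a i)" "i \<ge> 1 \<Longrightarrow> real_linear (adag i)"
  and ops_F: "i \<ge> 1 \<Longrightarrow> a i ` F \<subseteq> F" "i \<ge> 1 \<Longrightarrow> adag i ` F \<subseteq> F"
proof -
  have *: "bounded_clinear_on F (a i)" "bounded_clinear_on F (adag i)" if "i \<ge> 1" for i
    using ops that by (simp_all add: monotone_operators_def)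
  show "i \<ge> 1 \<Longrightarrow> real_linear (a i)" "i \<ge> 1 \<Longrightarrow> real_linear (adag i)"
    using * by (simp_all add: real_linear_bounded_clinear)
  show "i \<ge> 1 \<Longrightarrow> a i ` F \<subseteq> F" "i \<ge> 1 \<Longrightarrow> adag i ` F \<subseteq> F"
    using * unfolding bounded_clinear_on_def by blast+
qed

lemma words_upto_cases:
  assumes "w \<in> words_upto k"
  obtains "w = []"
  | j v where "w = j # v" "w \<in> monotone_words" "1 \<le> j" "j \<le> k" "v \<in> words_upto k"
proof (cases w)
  case (Cons j v)
  then show ?thesis
    using assms that(2) by (auto simp: words_upto_def monotone_words_def)
qed (use that in blast)

lemma words_upto_Cons: "w \<in> words_upto k \<Longrightarrow> k < i \<Longrightarrow> i # w \<in> monotone_words"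
  by (auto simp: words_upto_def monotone_words_def)

lemma a_word:
  assumes "i \<ge> 1"
  shows "a i (b []) = 0" "j # w \<in> monotone_words \<Longrightarrow> a i (b (j # w)) = (if i = j then b w else 0)"
    "adag i (b []) = b [i]"
    "j # w \<in> monotone_words \<Longrightarrow> adag i (b (j # w)) = (if i > j then b (i # j # w) else 0)"
proof -
  have *: "adag i \<Omega> = b [i] \<and> a i \<Omega> = 0 \<and> (\<forall>j w. j # w \<in> monotone_words \<longrightarrow>
      adag i (b (j # w)) = (if i > j then b (i # j # w) else 0) \<and>
      a i (b (j # w)) = (if i = j then b w else 0))"
    using ops assms unfolding monotone_operators_def by simp
  then show "a i (b []) = 0" "adag i (b []) = b [i]"
    by (simp_all add: basis_tensor_def)
  show "j # w \<in> monotone_words \<Longrightarrow> a i (b (j # w)) = (if i = j then b w else 0)"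
    "j # w \<in> monotone_words \<Longrightarrow> adag i (b (j # w)) = (if i > j then b (i # j # w) else 0)"
    using * by blast+
qed

lemma a_Suc_word:
  assumes "w \<in> words_upto k"
  shows "a (Suc k) (b w) = 0" "adag (Suc k) (b w) = b (Suc k # w)"
proof -
  show "a (Suc k) (b w) = 0"
    using assms by (cases rule: words_upto_cases) (simp_all add: a_word)
  show "adag (Suc k) (b w) = b (Suc k # w)"
    using assms by (cases rule: words_upto_cases) (simp_all add: a_word)
qed

text \<open>
  These are the entries of the block operator. Creation at \<open>k + 1\<close> embeds the vectors without the
  letter \<open>k + 1\<close> as a second copy. On the first copy annihilation at \<open>k + 1\<close> vanishes; on the second
  it undoes the creation, and the other operators with index at most \<open>k + 1\<close> vanish, since a letter
  that is not larger than \<open>k + 1\<close> cannot be put in front of a word starting with \<open>k + 1\<close>, and none but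
  \<open>k + 1\<close> itself can be removed from its front.
\<close>

lemma a_Suc_upto:
  assumes "x \<in> fock_upto k"
  shows "a (Suc k) x = 0"
  using real_linear_eqI[OF real_linear_ops(1) real_linear_const_zero assms, of "Suc k"] a_Suc_word(1)
  by simp

lemma real_linear_ops_adag:
  "i \<ge> 1 \<Longrightarrow> j \<ge> 1 \<Longrightarrow> real_linear (\<lambda>x. a i (adag j x))"
  "i \<ge> 1 \<Longrightarrow> j \<ge> 1 \<Longrightarrow> real_linear (\<lambda>x. adag i (adag j x))"
  by (rule real_linear_compose[OF real_linear_ops(1) real_linear_ops(2) ops_F(2)]
      real_linear_compose[OF real_linear_ops(2) real_linear_ops(2) ops_F(2)]; assumption)+

lemma a_adag_Suc_upto:
  assumes "x \<in> fock_upto k" "1 \<le> i" "i \<le> Suc k"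
  shows "a i (adag (Suc k) x) = (if i = Suc k then x else 0)"
proof (rule real_linear_eqI[OF real_linear_ops_adag(1) _ assms(1)])
  show "real_linear (\<lambda>x. if i = Suc k then x else 0)"
    by (cases "i = Suc k") (simp_all add: real_linear_const_zero real_linear_id)
  show "a i (adag (Suc k) (b w)) = (if i = Suc k then b w else 0)" if "w \<in> words_upto k" for w
    using that words_upto_Cons[OF that, of "Suc k"] assms(2) by (simp add: a_Suc_word a_word)
qed (use assms in auto)

lemma adag_adag_Suc_upto:
  assumes "x \<in> fock_upto k" "1 \<le> i" "i \<le> Suc k"
  shows "adag i (adag (Suc k) x) = 0"
proof (rule real_linear_eqI[OF real_linear_ops_adag(2) real_linear_const_zero assms(1)])
  show "adag i (adag (Suc k) (b w)) = 0" if "w \<in> words_upto k" for w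
    using that words_upto_Cons[OF that, of "Suc k"] assms(2,3) by (simp add: a_Suc_word a_word)
qed (use assms in auto)

lemma ops_upto:
  assumes "x \<in> fock_upto k" "1 \<le> i" "i \<le> k"
  shows "a i x \<in> fock_upto k" "adag i x \<in> fock_upto k"
proof -
  have "a i (b w) \<in> fock_upto k" if "w \<in> words_upto k" for w
    using that assms(2) by (cases rule: words_upto_cases) (auto simp: a_word fock_upto_word)
  then show "a i x \<in> fock_upto k"
    using real_linear_memI[OF real_linear_ops(1)] assms by blast
  have "adag i (b w) \<in> fock_upto k" if "w \<in> words_upto k" for w
    using that
  proof (cases rule: words_upto_cases)
    case 1
    then show ?thesis using assms
      by (auto simp: a_word words_upto_def monotone_words_def intro!: fock_upto_word)
  next
    case (2 j v)
    have "i # w \<in> words_upto k" if "j < i"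
    proof -
      have "\<forall>x\<in>set w. x < i"
        using that 2(1,2) by (auto simp: monotone_words_def)
      then show ?thesis
        using \<open>w \<in> words_upto k\<close> assms(2,3) by (simp add: words_upto_def monotone_words_def)
    qed
    then show ?thesis using 2 assms by (simp add: a_word fock_upto_word fock_upto_closed(1))
  qed
  then show "adag i x \<in> fock_upto k"
    using real_linear_memI[OF real_linear_ops(2)] assms by blast
qed

lemma cinner_vacuum: "cinner \<Omega> \<Omega> = 1"
proof -
  have "\<forall>xs ys. cinner (tensor xs) (tensor ys) =
      (if length xs = length ys then (\<Prod>k<length xs. cinner (xs ! k) (ys ! k)) else 0)"
    using fock by (simp add: full_fock_space_def)
  from this[rule_format, of "[]" "[]"] show ?thesis by simp
qed

lemma cinner_scaleR_left: "cinner (r *\<^sub>R x) y = of_real r * cinner (x :: 'f) y"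
  by (metis cinner_scaleC_left scaleC_of_real)

lemma cinner_zero_left: "cinner 0 (y :: 'f) = 0"
  using cinner_scaleR_left[of 0 0 y] by simp

lemma cinner_adag_vacuum:
  assumes "x \<in> F" "i \<ge> 1"
  shows "cinner (adag i x) \<Omega> = 0"
proof -
  have "\<Omega> \<in> F" using vacuum_in_fock_upto fock_upto_F by blast
  moreover have "\<forall>x\<in>F. \<forall>y\<in>F. cinner (a i x) y = cinner x (adag i y)" "a i \<Omega> = 0"
    using ops assms(2) unfolding monotone_operators_def by simp_all
  ultimately have "cinner \<Omega> (adag i x) = cinner 0 x"
    using assms(1) by metis
  then show ?thesis
    using cinner_commute[of "adag i x" \<Omega>] by (simp add: cinner_zero_left)
qed

end

locale scaled_poisson = monotone_fock +
  fixes s c :: real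
begin

definition T :: "nat \<Rightarrow> 'b \<Rightarrow> 'b"
  where "T k x = s *\<^sub>R poisson_sum a adag k c x"

lemma T_Suc:
  "T (Suc k) x = T k x + s *\<^sub>R (a (Suc k) x + adag (Suc k) x + c *\<^sub>R adag (Suc k) (a (Suc k) x))"
  by (simp add: T_def poisson_sum_def preservation_def scaleR_add_right)

text \<open>
  The two columns of the block operator: first on words with letters at most \<open>k\<close>, then on those
  preceded by \<open>k + 1\<close>.
\<close>

lemma T_Suc_upto: "x \<in> fock_upto k \<Longrightarrow> T (Suc k) x = T k x + s *\<^sub>R adag (Suc k) x"
  by (simp add: T_Suc a_Suc_upto real_linear_zero real_linear_ops)

lemma T_Suc_adag_upto:
  assumes "x \<in> fock_upto k"
  shows "T (Suc k) (adag (Suc k) x) = s *\<^sub>R x + (s * c) *\<^sub>R adag (Suc k) x"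
proof -
  have "T k (adag (Suc k) x) = 0"
    unfolding T_def poisson_sum_def preservation_def
    using assms by (simp add: a_adag_Suc_upto adag_adag_Suc_upto real_linear_zero real_linear_ops)
  then show ?thesis
    using assms by (simp add: T_Suc a_adag_Suc_upto adag_adag_Suc_upto scaleR_add_right)
qed

lemma T_upto: "x \<in> fock_upto k \<Longrightarrow> T k x \<in> fock_upto k"
  unfolding T_def poisson_sum_def preservation_def
  by (intro fock_upto_closed(3))
    (auto simp: fock_upto_def intro!: span_sum span_add span_scale ops_upto[unfolded fock_upto_def])

lemma real_linear_T: "real_linear (T k)"
proof -
  have 1: "f (x + y) = f x + f y" "f (r *\<^sub>R x) = r *\<^sub>R f x"
    if "real_linear f" "x \<in> F" "y \<in> F" for f x y r
    using that unfolding real_linear_def by blast+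
  show ?thesis
    unfolding real_linear_def T_def poisson_sum_def preservation_def o_def
  proof (intro conjI ballI allI)
    fix x y r assume xy: "x \<in> F" "y \<in> F"
    have aF: "a i x \<in> F" "a i y \<in> F" if "i \<ge> 1" for i using xy ops_F that by blast+
    show "s *\<^sub>R (\<Sum>i = 1..k. a i (x + y) + adag i (x + y) + c *\<^sub>R adag i (a i (x + y))) =
      s *\<^sub>R (\<Sum>i = 1..k. a i x + adag i x + c *\<^sub>R adag i (a i x)) +
      s *\<^sub>R (\<Sum>i = 1..k. a i y + adag i y + c *\<^sub>R adag i (a i y))"
      using xy aF by (simp add: 1 real_linear_ops scaleR_add_right sum.distrib)
  next
    fix x r assume x: "x \<in> F"
    have aF: "a i x \<in> F" if "i \<ge> 1" for i using x ops_F that by blast+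
    show "s *\<^sub>R (\<Sum>i = 1..k. a i (r *\<^sub>R x) + adag i (r *\<^sub>R x) + c *\<^sub>R adag i (a i (r *\<^sub>R x))) =
      r *\<^sub>R s *\<^sub>R (\<Sum>i = 1..k. a i x + adag i x + c *\<^sub>R adag i (a i x))"
      using x aF by (simp add: 1 real_linear_ops scaleR_sum_right algebra_simps)
  qed
qed

lemma T_power_upto: "x \<in> fock_upto k \<Longrightarrow> (T k ^^ i) x \<in> fock_upto k"
  by (induction i) (auto intro: T_upto)

lemma T_power_linear:
  assumes "x \<in> fock_upto k" "y \<in> fock_upto k"
  shows "(T k ^^ i) (x + y) = (T k ^^ i) x + (T k ^^ i) y"
    and "(T k ^^ i) (r *\<^sub>R x) = r *\<^sub>R (T k ^^ i) x"
  by (induction i)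
     (simp_all add: real_linear_upto[OF real_linear_T T_power_upto[OF assms(1)] T_power_upto[OF assms(2)]])

text \<open>
  The powers of the block operator are read off from the matrix powers, with \<open>T\<^sub>k\<close> in place of the
  number \<open>w\<close>. Instead of a functional calculus, the induction carries the pairing of \<open>T\<^sub>k\<^sup>i p\<close> and
  \<open>T\<^sub>k\<^sup>i q\<close> with the vacuum for every \<open>i\<close>: multiplication by \<open>w\<close> corresponds to raising \<open>i\<close> by one.
\<close>

lemma vacuum_moments_Suc:
  assumes IH: "\<And>i. cinner ((T k ^^ i) \<Omega>) \<Omega> =
      complex_of_real (measure_pmf.expectation (chain_law s (s * c) k) (\<lambda>x. x ^ i))"
  shows "\<exists>p\<in>fock_upto k. \<exists>q\<in>fock_upto k. (T (Suc k) ^^ n) \<Omega> = p + adag (Suc k) q \<and>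
    (\<forall>i. cinner ((T k ^^ i) p) \<Omega> = complex_of_real (measure_pmf.expectation
       (chain_law s (s * c) k) (\<lambda>x. x ^ i * block_top s (s * c) x n)) \<and>
     cinner ((T k ^^ i) q) \<Omega> = complex_of_real (measure_pmf.expectation
       (chain_law s (s * c) k) (\<lambda>x. x ^ i * block_bot s (s * c) x n)))"
proof (induction n)
  case 0
  have "(T k ^^ i) 0 = 0" for i
    using T_power_linear(2)[OF vacuum_in_fock_upto vacuum_in_fock_upto, where k = k and i = i and r = 0] by simp
  then show ?case
    by (intro bexI[of _ \<Omega>] bexI[of _ 0])
       (auto simp: IH vacuum_in_fock_upto cinner_zero_left real_linear_zero real_linear_ops)
next
  case (Suc n)
  then obtain p q where pq: "p \<in> fock_upto k" "q \<in> fock_upto k"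
    and eq: "(T (Suc k) ^^ n) \<Omega> = p + adag (Suc k) q"
    and mp: "\<And>i. cinner ((T k ^^ i) p) \<Omega> = complex_of_real (measure_pmf.expectation
       (chain_law s (s * c) k) (\<lambda>x. x ^ i * block_top s (s * c) x n))"
    and mq: "\<And>i. cinner ((T k ^^ i) q) \<Omega> = complex_of_real (measure_pmf.expectation
       (chain_law s (s * c) k) (\<lambda>x. x ^ i * block_bot s (s * c) x n))"
    by blast
  have F: "p \<in> F" "q \<in> F" "adag (Suc k) q \<in> F"
    using pq fock_upto_F ops_F(2)[of "Suc k"] by auto
  have "(T (Suc k) ^^ Suc n) \<Omega> = T (Suc k) (p + adag (Suc k) q)"
    by (simp add: eq)
  also have "\<dots> = T (Suc k) p + T (Suc k) (adag (Suc k) q)"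
    using real_linear_T F unfolding real_linear_def by blast
  also have "\<dots> = (T k p + s *\<^sub>R q) + (s *\<^sub>R adag (Suc k) p + (s * c) *\<^sub>R adag (Suc k) q)"
    by (simp add: T_Suc_upto T_Suc_adag_upto pq)
  also have "s *\<^sub>R adag (Suc k) p + (s * c) *\<^sub>R adag (Suc k) q = adag (Suc k) (s *\<^sub>R p + (s * c) *\<^sub>R q)"
    using real_linear_upto(1)[OF real_linear_ops(2) fock_upto_closed(3)[OF pq(1)] fock_upto_closed(3)[OF pq(2)]]
      real_linear_upto(2)[OF real_linear_ops(2) pq(1) pq(1)]
      real_linear_upto(2)[OF real_linear_ops(2) pq(2) pq(2)]
    by simp
  finally have 1: "(T (Suc k) ^^ Suc n) \<Omega> = (T k p + s *\<^sub>R q) + adag (Suc k) (s *\<^sub>R p + (s * c) *\<^sub>R q)" .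
  have 2: "cinner ((T k ^^ i) (T k p + s *\<^sub>R q)) \<Omega> = complex_of_real (measure_pmf.expectation
       (chain_law s (s * c) k) (\<lambda>x. x ^ i * block_top s (s * c) x (Suc n)))" for i
  proof -
    have "(T k ^^ i) (T k p + s *\<^sub>R q) = (T k ^^ Suc i) p + s *\<^sub>R (T k ^^ i) q"
      using pq by (simp add: T_power_linear T_upto fock_upto_closed(3) funpow_swap1)
    also have "cinner \<dots> \<Omega> = cinner ((T k ^^ Suc i) p) \<Omega> + of_real s * cinner ((T k ^^ i) q) \<Omega>"
      by (simp only: cinner_add_left cinner_scaleR_left)
    finally show ?thesis
      unfolding mp mq by (simp add: algebra_simps)
  qed
  have 3: "cinner ((T k ^^ i) (s *\<^sub>R p + (s * c) *\<^sub>R q)) \<Omega> = complex_of_real (measure_pmf.expectation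
       (chain_law s (s * c) k) (\<lambda>x. x ^ i * block_bot s (s * c) x (Suc n)))" for i
  proof -
    have "(T k ^^ i) (s *\<^sub>R p + (s * c) *\<^sub>R q) = s *\<^sub>R (T k ^^ i) p + (s * c) *\<^sub>R (T k ^^ i) q"
      using pq by (simp add: T_power_linear fock_upto_closed(3))
    also have "cinner \<dots> \<Omega> = of_real s * cinner ((T k ^^ i) p) \<Omega> + of_real (s * c) * cinner ((T k ^^ i) q) \<Omega>"
      by (simp only: cinner_add_left cinner_scaleR_left)
    finally show ?thesis
      unfolding mp mq by (simp add: algebra_simps)
  qed
  show ?case
    using 1 2 3 pq by (intro bexI[of _ "T k p + s *\<^sub>R q"] bexI[of _ "s *\<^sub>R p + (s * c) *\<^sub>R q"])
      (auto intro: T_upto)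
qed

text \<open>
  The component \<open>q\<close> drops out because created vectors are orthogonal to the vacuum, and the
  remaining average over the chain is one more step of the chain. The case \<open>k = 0\<close> is listed
  separately for the sake of \<open>m = 0\<close>, where the scaling factor \<open>1 / \<surd>m\<close> is \<open>0\<close>.
\<close>

lemma vacuum_moments:
  assumes "k = 0 \<or> s > 0"
  shows "cinner ((T k ^^ n) \<Omega>) \<Omega> =
    complex_of_real (measure_pmf.expectation (chain_law s (s * c) k) (\<lambda>x. x ^ n))"
  using assms
proof (induction k arbitrary: n)
  case 0
  have "T 0 = (\<lambda>x. 0)" by (simp add: T_def poisson_sum_def fun_eq_iff)
  then show ?case
    by (cases n) (simp_all add: cinner_vacuum cinner_zero_left)
next
  case (Suc k)
  then have s: "s > 0" by simp
  have IH: "\<And>i. cinner ((T k ^^ i) \<Omega>) \<Omega> =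
      complex_of_real (measure_pmf.expectation (chain_law s (s * c) k) (\<lambda>x. x ^ i))"
    using Suc.IH s by blast
  obtain p q where pq: "p \<in> fock_upto k" "q \<in> fock_upto k"
    and eq: "(T (Suc k) ^^ n) \<Omega> = p + adag (Suc k) q"
    and mp: "\<And>i. cinner ((T k ^^ i) p) \<Omega> = complex_of_real (measure_pmf.expectation
       (chain_law s (s * c) k) (\<lambda>x. x ^ i * block_top s (s * c) x n))"
    using vacuum_moments_Suc[OF IH] by meson
  have "cinner ((T (Suc k) ^^ n) \<Omega>) \<Omega> = cinner p \<Omega>"
    unfolding eq using pq fock_upto_F by (simp add: cinner_add_left cinner_adag_vacuum)
  also have "\<dots> = complex_of_real (measure_pmf.expectation (chain_law s (s * c) k)
      (\<lambda>w. block_top s (s * c) w n))"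
    using mp[of 0] by simp
  finally show ?case
    by (simp only: expectation_chain_law_Suc block_law_moment[OF s])
qed

end


section \<open>Asymptotics of the moments of the chain\<close>

text \<open>
  Centred moments of one step of the chain, as a function of the centred starting point \<open>v\<close> and of
  \<open>h = s\<^sup>2\<close>; the recursion is the equation \<open>u\<^sup>2 = v u + h\<close> multiplied by \<open>u\<^sup>n\<close> and averaged.
\<close>

fun step_moment :: "real \<Rightarrow> real \<Rightarrow> nat \<Rightarrow> real"
  where
    "step_moment v h 0 = 1"
  | "step_moment v h (Suc 0) = v"
  | "step_moment v h (Suc (Suc n)) = v * step_moment v h (Suc n) + h * step_moment v h n"

lemma block_law_central_moment:
  assumes "s > 0"
  shows "measure_pmf.expectation (block_law s l w) (\<lambda>x. (x - l) ^ n) = step_moment (w - l) (s\<^sup>2) n"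
proof -
  define v p q a where "v = w - l" and "p = root_plus s v" and "q = root_minus s v"
    and "a = weight_plus s v"
  have E: "measure_pmf.expectation (block_law s l w) (\<lambda>x. (x - l) ^ n) = a * p ^ n + (1 - a) * q ^ n" for n
    by (simp add: expectation_block_law[OF assms] p_def q_def v_def a_def)
  have sq: "p\<^sup>2 = v * p + s\<^sup>2" "q\<^sup>2 = v * q + s\<^sup>2"
    using root_eq by (simp_all add: p_def q_def)
  have "p - q > 0" using root_signs[OF assms, of v] by (simp add: p_def q_def)
  then have "a * (p - q) = p" by (simp add: a_def weight_plus_def flip: p_def q_def)
  then have mean: "a * p + (1 - a) * q = v"
    using root_plus_minus_sum[of s v] by (simp add: p_def q_def algebra_simps)
  have "a * p ^ n + (1 - a) * q ^ n = step_moment v (s\<^sup>2) n"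
  proof (induction n rule: induct_nat_012)
    case (ge2 n)
    have "a * p ^ Suc (Suc n) + (1 - a) * q ^ Suc (Suc n) = a * p ^ n * p\<^sup>2 + (1 - a) * q ^ n * q\<^sup>2"
      by (simp add: power2_eq_square)
    also have "\<dots> = v * (a * p ^ Suc n + (1 - a) * q ^ Suc n) + s\<^sup>2 * (a * p ^ n + (1 - a) * q ^ n)"
      by (simp add: sq algebra_simps)
    finally show ?case using ge2 by simp
  qed (use mean in simp_all)
  then show ?thesis by (simp add: E v_def)
qed

context
  fixes v h Q :: real
  assumes v: "\<bar>v\<bar> \<le> Q - 1" and h: "0 \<le> h" "h \<le> 1"
begin

lemma step_moment_bound: "\<bar>step_moment v h n\<bar> \<le> Q ^ n"
proof (induction n rule: induct_nat_012)
  case (ge2 n)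
  have "\<bar>step_moment v h (Suc (Suc n))\<bar> \<le> \<bar>v\<bar> * \<bar>step_moment v h (Suc n)\<bar> + h * \<bar>step_moment v h n\<bar>"
    using h by (simp add: abs_mult order_trans[OF abs_triangle_ineq])
  also have "\<dots> \<le> (Q - 1) * Q ^ Suc n + 1 * Q ^ n"
    using ge2 v h by (intro add_mono mult_mono) auto
  also have "\<dots> \<le> Q ^ Suc (Suc n)"
    using power_increasing[of n "Suc n" Q] v by (simp add: algebra_simps)
  finally show ?case .
qed (use v in auto)

lemma step_moment_order1: "\<bar>step_moment v h n - v ^ n\<bar> \<le> real n * Q ^ n * h"
proof (induction n rule: induct_nat_012)
  case (ge2 n)
  have Q: "Q \<ge> 1" using v by simp
  have "step_moment v h (Suc (Suc n)) - v ^ Suc (Suc n) =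
      v * (step_moment v h (Suc n) - v ^ Suc n) + h * step_moment v h n"
    by (simp add: algebra_simps)
  also have "\<bar>\<dots>\<bar> \<le> \<bar>v\<bar> * \<bar>step_moment v h (Suc n) - v ^ Suc n\<bar> + h * \<bar>step_moment v h n\<bar>"
    using h by (metis abs_mult abs_of_nonneg abs_triangle_ineq)
  also have "\<dots> \<le> Q * (real (Suc n) * Q ^ Suc n * h) + h * Q ^ n"
    using ge2 v h step_moment_bound by (intro add_mono mult_mono) auto
  also have "h * Q ^ n \<le> h * Q ^ Suc (Suc n)"
    using Q h by (intro mult_left_mono power_increasing) auto
  finally show ?case by (simp add: algebra_simps)
qed (use v h in auto)

text \<open>
  The error \<open>e\<^sub>n\<close> satisfies \<open>e\<^bsub>n+1\<^esub> = v e\<^sub>n + h (r\<^bsub>n+1\<^esub> - v\<^bsup>n+1\<^esup>)\<close>, where \<open>r\<close> denotes the step moment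
  and the last bracket is already of order \<open>h\<close>. The bound \<open>\<bar>v\<bar> \<le> Q - 1\<close> leaves the room that makes
  the explicit constants inductive.
\<close>

lemma step_moment_order2:
  "\<bar>step_moment v h (n + 2) - v ^ (n + 2) - real (n + 1) * h * v ^ n\<bar>
    \<le> (real n)\<^sup>2 * Q ^ Suc n * h\<^sup>2"
proof (induction n)
  case 0
  then show ?case by (simp add: numeral_2_eq_2)
next
  case (Suc n)
  define e where "e = step_moment v h (n + 2) - v ^ (n + 2) - real (n + 1) * h * v ^ n"
  have Q: "Q \<ge> 1" using v by simp
  have "step_moment v h (Suc n + 2) - v ^ (Suc n + 2) - real (Suc n + 1) * h * v ^ Suc n =
      v * e + h * (step_moment v h (Suc n) - v ^ Suc n)"
    by (simp add: e_def algebra_simps numeral_2_eq_2)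
  also have "\<bar>\<dots>\<bar> \<le> \<bar>v\<bar> * \<bar>e\<bar> + h * \<bar>step_moment v h (Suc n) - v ^ Suc n\<bar>"
    using h by (metis abs_mult abs_of_nonneg abs_triangle_ineq)
  also have "\<dots> \<le> Q * ((real n)\<^sup>2 * Q ^ Suc n * h\<^sup>2) + h * (real (Suc n) * Q ^ Suc n * h)"
    using Suc v h step_moment_order1[of "Suc n"] unfolding e_def
    by (intro add_mono mult_mono) auto
  also have "h * (real (Suc n) * Q ^ Suc n * h) \<le> real (Suc n) * Q ^ Suc (Suc n) * h\<^sup>2"
    using Q h mult_right_mono[OF power_increasing[of "Suc n" "Suc (Suc n)" Q], of "real (Suc n) * h\<^sup>2"]
    by (simp add: power2_eq_square mult_ac)
  also have "Q * ((real n)\<^sup>2 * Q ^ Suc n * h\<^sup>2) + real (Suc n) * Q ^ Suc (Suc n) * h\<^sup>2 =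
      ((real n)\<^sup>2 + real (Suc n)) * (Q ^ Suc (Suc n) * h\<^sup>2)"
    by (simp add: algebra_simps)
  also have "\<dots> \<le> (real (Suc n))\<^sup>2 * (Q ^ Suc (Suc n) * h\<^sup>2)"
    using Q h by (intro mult_right_mono) (auto simp: power2_eq_square algebra_simps)
  finally show ?case by (simp add: mult_ac)
qed

end

text \<open>
  The moments of \<open>\<surd>(2 - u\<^sup>2) / \<pi>\<close> on \<open>[-\<surd>2, \<surd>2]\<close>, see \<open>disc_integral\<close> below.
\<close>

fun disc_moment :: "nat \<Rightarrow> real"
  where
    "disc_moment 0 = 1"
  | "disc_moment (Suc 0) = 0"
  | "disc_moment (Suc (Suc n)) = 2 * real (n + 1) / real (n + 4) * disc_moment n"

text \<open>
  For even \<open>n\<close> the exponent \<open>n div 2 + 1\<close> is \<open>n / 2 + 1\<close>; for odd \<open>n\<close> the whole term vanishes, so the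
  rounding does not matter. In terms of generating functions this recursion is
  \<open>(z\<^sup>2 - 2t - l\<^sup>2) G(z) = \<surd>(z\<^sup>2 - 2t) - l\<close>, that is, \<open>G(z) = 1 / (l + \<surd>(z\<^sup>2 - 2t))\<close>.
\<close>

fun limit_moment :: "real \<Rightarrow> real \<Rightarrow> nat \<Rightarrow> real"
  where
    "limit_moment l t 0 = 1"
  | "limit_moment l t (Suc 0) = - l"
  | "limit_moment l t (Suc (Suc n)) =
      (l\<^sup>2 + 2 * t) * limit_moment l t n - disc_moment n * t ^ (n div 2 + 1)"

lemma disc_moment_odd: "odd n \<Longrightarrow> disc_moment n = 0"
  by (induction n rule: disc_moment.induct) auto

lemma disc_moment_half: "real (n div 2 + 2) * disc_moment (Suc (Suc n)) = real (n + 1) * disc_moment n"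
proof (cases "even n")
  case True
  then obtain k where "n = 2 * k" by (auto elim: evenE)
  then show ?thesis by (simp add: field_simps)
qed (simp add: disc_moment_odd)

text \<open>
  Differentiating the recursion and substituting it back, the powers of \<open>t\<close> cancel precisely
  because of \<open>disc_moment_half\<close>.
\<close>

lemma limit_moment_deriv:
  "((\<lambda>t. limit_moment l t (Suc (Suc n))) has_real_derivative
    real (n + 1) * limit_moment l t n) (at t)"
proof (induction n rule: induct_nat_012)
  case 0
  show ?case by (auto intro!: derivative_eq_intros)
next
  case 1
  show ?case by (auto intro!: derivative_eq_intros)
next
  case (ge2 n)
  have "((\<lambda>t. (l\<^sup>2 + 2 * t) * limit_moment l t (Suc (Suc n)) -
      disc_moment (Suc (Suc n)) * t ^ (n div 2 + 2)) has_real_derivative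
    2 * limit_moment l t (Suc (Suc n)) + (l\<^sup>2 + 2 * t) * (real (n + 1) * limit_moment l t n) -
      disc_moment (Suc (Suc n)) * (real (n div 2 + 2) * t ^ (n div 2 + 1))) (at t)"
    by (rule derivative_eq_intros ge2(1) refl | simp)+
  moreover have "(l\<^sup>2 + 2 * t) * (real (n + 1) * limit_moment l t n) =
      real (n + 1) * (limit_moment l t (Suc (Suc n)) + disc_moment n * t ^ (n div 2 + 1))"
    by simp
  moreover have "disc_moment (Suc (Suc n)) * (real (n div 2 + 2) * t ^ (n div 2 + 1)) =
      real (n + 1) * disc_moment n * t ^ (n div 2 + 1)"
    using disc_moment_half[of n] by (metis mult.assoc mult.commute)
  ultimately have "((\<lambda>t. (l\<^sup>2 + 2 * t) * limit_moment l t (Suc (Suc n)) -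
      disc_moment (Suc (Suc n)) * t ^ (n div 2 + 2)) has_real_derivative
    2 * limit_moment l t (Suc (Suc n)) + real (n + 1) * (limit_moment l t (Suc (Suc n))
      + disc_moment n * t ^ (n div 2 + 1)) - real (n + 1) * disc_moment n * t ^ (n div 2 + 1)) (at t)"
    by (simp only:)
  moreover have "2 * limit_moment l t (Suc (Suc n)) + real (n + 1) * (limit_moment l t (Suc (Suc n))
      + disc_moment n * t ^ (n div 2 + 1)) - real (n + 1) * disc_moment n * t ^ (n div 2 + 1) =
      real (Suc (Suc n) + 1) * limit_moment l t (Suc (Suc n))"
    by (simp only: of_nat_Suc of_nat_add of_nat_1 ring_distribs mult.assoc)
  moreover have "(\<lambda>t. limit_moment l t (Suc (Suc (Suc (Suc n))))) =
     (\<lambda>t. (l\<^sup>2 + 2 * t) * limit_moment l t (Suc (Suc n)) -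
      disc_moment (Suc (Suc n)) * t ^ (n div 2 + 2))"
    by (intro ext, subst limit_moment.simps(3)) simp
  ultimately show ?case by (simp only:)
qed

lemma limit_moment_bounded: "\<exists>B\<ge>0. \<forall>t. 0 \<le> t \<longrightarrow> t \<le> 1 \<longrightarrow> \<bar>limit_moment l t n\<bar> \<le> B"
proof -
  have "continuous_on {0..1} (\<lambda>t. limit_moment l t n)"
    by (induction n rule: induct_nat_012) (auto intro!: continuous_intros)
  then have "bounded ((\<lambda>t. limit_moment l t n) ` {0..1})"
    by (intro compact_imp_bounded compact_continuous_image) auto
  then obtain B where "\<forall>t\<in>{0..1}. \<bar>limit_moment l t n\<bar> \<le> B"
    by (auto simp: bounded_iff)
  then show ?thesis
    by (intro exI[of _ "max 0 B"]) (auto simp: le_max_iff_disj)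
qed

lemma limit_moment_increment:
  assumes "a < b"
  obtains z where "a < z" "z < b"
    "limit_moment l b (Suc (Suc n)) - limit_moment l a (Suc (Suc n)) =
      (b - a) * (real (n + 1) * limit_moment l z n)"
  using MVT2[OF assms limit_moment_deriv[of l n]] by metis

lemma limit_moment_lipschitz:
  "\<exists>L\<ge>0. \<forall>a b. 0 \<le> a \<longrightarrow> a < b \<longrightarrow> b \<le> 1 \<longrightarrow>
    \<bar>limit_moment l b n - limit_moment l a n\<bar> \<le> L * (b - a)"
proof (cases n rule: disc_moment.cases)
  case (3 k)
  obtain B where B: "B \<ge> 0" "\<And>t. 0 \<le> t \<Longrightarrow> t \<le> 1 \<Longrightarrow> \<bar>limit_moment l t k\<bar> \<le> B"
    using limit_moment_bounded by metis
  have "\<bar>limit_moment l b n - limit_moment l a n\<bar> \<le> real (k + 1) * B * (b - a)"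
    if ab: "0 \<le> a" "a < b" "b \<le> 1" for a b
  proof -
    obtain z where z: "a < z" "z < b" and eq: "limit_moment l b (Suc (Suc k)) -
        limit_moment l a (Suc (Suc k)) = (b - a) * (real (k + 1) * limit_moment l z k)"
      using limit_moment_increment[OF ab(2)] by metis
    have "\<bar>limit_moment l z k\<bar> \<le> B" using z ab by (intro B) auto
    then show ?thesis
      unfolding 3 eq abs_mult using ab by (simp add: mult_ac mult_left_mono)
  qed
  then show ?thesis using B(1) by (intro exI[of _ "real (k + 1) * B"]) auto
qed (auto intro!: exI[of _ 0])

text \<open>
  The mean value theorem gives the increment with the derivative at an intermediate time, and the
  Lipschitz bound of \<open>N\<^sub>n\<close> replaces that time by \<open>t\<close> at the cost of another factor \<open>h\<close>.
\<close>

lemma limit_moment_euler_step: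
  "\<exists>D\<ge>0. \<forall>t h. 0 \<le> t \<longrightarrow> 0 < h \<longrightarrow> t + h \<le> 1 \<longrightarrow>
    \<bar>limit_moment l (t + h) (n + 2) - limit_moment l t (n + 2) - real (n + 1) * h * limit_moment l t n\<bar>
      \<le> D * h\<^sup>2"
proof -
  obtain L where L: "L \<ge> 0" "\<And>a b. 0 \<le> a \<Longrightarrow> a < b \<Longrightarrow> b \<le> 1 \<Longrightarrow>
      \<bar>limit_moment l b n - limit_moment l a n\<bar> \<le> L * (b - a)"
    using limit_moment_lipschitz by metis
  have "\<bar>limit_moment l (t + h) (n + 2) - limit_moment l t (n + 2) - real (n + 1) * h * limit_moment l t n\<bar>
      \<le> real (n + 1) * L * h\<^sup>2" if th: "0 \<le> t" "0 < h" "t + h \<le> 1" for t h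
  proof -
    have "t < t + h" using th by simp
    then obtain z where z: "t < z" "z < t + h" and eq: "limit_moment l (t + h) (Suc (Suc n)) -
        limit_moment l t (Suc (Suc n)) = (t + h - t) * (real (n + 1) * limit_moment l z n)"
      using limit_moment_increment by metis
    have "limit_moment l (t + h) (n + 2) - limit_moment l t (n + 2) - real (n + 1) * h * limit_moment l t n
        = real (n + 1) * h * (limit_moment l z n - limit_moment l t n)"
      using eq by (simp only: add_2_eq_Suc') (simp add: algebra_simps)
    also have "\<bar>\<dots>\<bar> = real (n + 1) * h * \<bar>limit_moment l z n - limit_moment l t n\<bar>"
      using th by (simp add: abs_mult)
    also have "\<dots> \<le> real (n + 1) * h * (L * (z - t))"
      using z th by (intro mult_left_mono L) auto
    also have "\<dots> \<le> real (n + 1) * h * (L * h)"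
      using z th L(1) by (intro mult_left_mono) auto
    finally show ?thesis by (simp add: power2_eq_square mult_ac)
  qed
  then show ?thesis using L(1) by (intro exI[of _ "real (n + 1) * L"]) auto
qed

definition chain_moment :: "real \<Rightarrow> nat \<Rightarrow> nat \<Rightarrow> nat \<Rightarrow> real"
  where "chain_moment l m k n =
    measure_pmf.expectation (chain_law (1 / sqrt (real m)) l k) (\<lambda>x. (x - l) ^ n)"

lemma chain_moment_0: "chain_moment l m 0 n = (- l) ^ n"
  by (simp add: chain_moment_def)

lemma chain_moment_Suc:
  assumes "m > 0"
  shows "chain_moment l m (Suc k) n =
    measure_pmf.expectation (chain_law (1 / sqrt (real m)) l k)
      (\<lambda>x. step_moment (x - l) (1 / real m) n)"
proof -
  have "1 / sqrt (real m) > 0" using assms by simp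
  then show ?thesis
    unfolding chain_moment_def expectation_chain_law_Suc
    by (simp add: block_law_central_moment power_divide)
qed

lemma chain_law_support_uniform:
  assumes "k \<le> m" "x \<in> set_pmf (chain_law (1 / sqrt (real m)) l k)"
  shows "\<bar>x - l\<bar> \<le> sqrt (l\<^sup>2 + 2)"
proof (cases "k = 0")
  case True
  then show ?thesis using assms by (simp add: real_le_rsqrt)
next
  case False
  then have "m > 0" using assms(1) by simp
  then have "(x - l)\<^sup>2 \<le> l\<^sup>2 + 2 * real k * (1 / sqrt (real m))\<^sup>2"
    using assms(2) by (intro chain_law_support) auto
  also have "\<dots> \<le> l\<^sup>2 + 2"
    using \<open>m > 0\<close> assms(1) by (simp add: power_divide pos_divide_le_eq)
  finally show ?thesis by (simp add: real_le_rsqrt)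
qed

text \<open>
  The pointwise expansion of one step may be averaged over the chain because its constants are
  uniform on the common support.
\<close>

lemma chain_moment_step:
  assumes "m > 0" "k < m"
  shows "\<bar>chain_moment l m (Suc k) (n + 2) - chain_moment l m k (n + 2)
      - real (n + 1) * (1 / real m) * chain_moment l m k n\<bar>
    \<le> (real n)\<^sup>2 * (sqrt (l\<^sup>2 + 2) + 1) ^ Suc n * (1 / real m)\<^sup>2"
proof -
  define \<mu> where "\<mu> = chain_law (1 / sqrt (real m)) l k"
  define h where "h = 1 / real m"
  define g where "g x = step_moment (x - l) h (n + 2) - (x - l) ^ (n + 2) - real (n + 1) * h * (x - l) ^ n" for x
  have [simp]: "integrable (measure_pmf \<mu>) f" for f :: "real \<Rightarrow> real"
    unfolding \<mu>_def by simp
  have "chain_moment l m (Suc k) (n + 2) - chain_moment l m k (n + 2)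
      - real (n + 1) * h * chain_moment l m k n = measure_pmf.expectation \<mu> g"
    unfolding chain_moment_Suc[OF assms(1)] g_def
    by (simp add: chain_moment_def flip: \<mu>_def h_def)
  also have "\<bar>\<dots>\<bar> \<le> measure_pmf.expectation \<mu> (\<lambda>x. \<bar>g x\<bar>)"
    by (rule integral_abs_bound)
  also have "\<dots> \<le> measure_pmf.expectation \<mu> (\<lambda>x. (real n)\<^sup>2 * (sqrt (l\<^sup>2 + 2) + 1) ^ Suc n * h\<^sup>2)"
  proof (intro integral_mono_AE)
    show "AE x in \<mu>. \<bar>g x\<bar> \<le> (real n)\<^sup>2 * (sqrt (l\<^sup>2 + 2) + 1) ^ Suc n * h\<^sup>2"
      unfolding g_def AE_measure_pmf_iff \<mu>_def
      using chain_law_support_uniform[of k m _ l] assms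
      by (intro ballI step_moment_order2) (auto simp: h_def)
  qed simp_all
  finally show ?thesis by (simp add: h_def)
qed

text \<open>
  Convergence of the Euler scheme. The system is triangular, so the induction on \<open>n\<close> supplies the
  driving term, and the \<open>k \<le> m\<close> local errors of size \<open>O(1 / m\<^sup>2)\<close> add up to \<open>O(1 / m)\<close>.
\<close>

lemma chain_moment_converges:
  "\<exists>K\<ge>0. \<forall>m>0. \<forall>k\<le>m. \<bar>chain_moment l m k n - limit_moment l (real k / real m) n\<bar> \<le> K / real m"
proof (induction n rule: disc_moment.induct)
  case 1
  show ?case by (auto simp: chain_moment_def intro!: exI[of _ 0])
next
  case 2
  have "chain_moment l m k (Suc 0) = - l" if "m > 0" for m k
  proof (induction k)
    case (Suc k)
    then show ?case using chain_moment_Suc[OF that, of l k "Suc 0"] by (simp add: chain_moment_def)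
  qed (simp add: chain_moment_0)
  then show ?case by (auto intro!: exI[of _ 0])
next
  case (3 n)
  then obtain K where K: "K \<ge> 0" "\<And>m k. m > 0 \<Longrightarrow> k \<le> m \<Longrightarrow>
      \<bar>chain_moment l m k n - limit_moment l (real k / real m) n\<bar> \<le> K / real m"
    by metis
  obtain D where D: "D \<ge> 0" "\<And>t h. 0 \<le> t \<Longrightarrow> 0 < h \<Longrightarrow> t + h \<le> 1 \<Longrightarrow>
    \<bar>limit_moment l (t + h) (n + 2) - limit_moment l t (n + 2) - real (n + 1) * h * limit_moment l t n\<bar>
      \<le> D * h\<^sup>2"
    using limit_moment_euler_step by metis
  define C where "C = (real n)\<^sup>2 * (sqrt (l\<^sup>2 + 2) + 1) ^ Suc n"
  have "C \<ge> 0" by (simp add: C_def)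
  define A where "A = C + D + real (n + 1) * K"
  have "A \<ge> 0" using \<open>C \<ge> 0\<close> D(1) K(1) by (simp add: A_def)
  have *: "\<bar>chain_moment l m k (n + 2) - limit_moment l (real k / real m) (n + 2)\<bar> \<le> A / real m"
    if "m > 0" "k \<le> m" for m k
  proof -
    define h where "h = 1 / real m"
    have h: "h > 0" using that by (simp add: h_def)
    have "\<bar>chain_moment l m k (n + 2) - limit_moment l (real k * h) (n + 2)\<bar> \<le> real k * (A * h\<^sup>2)"
      using that(2)
    proof (induction k)
      case 0
      have "limit_moment l 0 n = (- l) ^ n" for n
        by (induction n rule: induct_nat_012) (auto simp: power2_eq_square)
      then show ?case by (simp only: chain_moment_0) (simp add: power2_eq_square)
    next
      case (Suc k)
      define t where "t = real k * h"
      have th: "0 \<le> t" "t + h \<le> 1" "real (Suc k) * h = t + h"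
        using Suc.prems that(1) by (auto simp: t_def h_def field_simps)
      have 1: "\<bar>chain_moment l m (Suc k) (n + 2) - chain_moment l m k (n + 2)
          - real (n + 1) * h * chain_moment l m k n\<bar> \<le> C * h\<^sup>2"
        using chain_moment_step[of m k l n] Suc.prems that(1) unfolding C_def h_def by simp
      have 2: "\<bar>limit_moment l (t + h) (n + 2) - limit_moment l t (n + 2)
          - real (n + 1) * h * limit_moment l t n\<bar> \<le> D * h\<^sup>2"
        using th h by (intro D) auto
      have "\<bar>chain_moment l m k n - limit_moment l t n\<bar> \<le> K * h"
        using K(2)[OF that(1), of k] Suc.prems by (simp add: t_def h_def)
      then have "real (n + 1) * h * \<bar>chain_moment l m k n - limit_moment l t n\<bar> \<le> real (n + 1) * h * (K * h)"
        using h by (intro mult_left_mono) auto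
      then have 3: "\<bar>real (n + 1) * h * chain_moment l m k n - real (n + 1) * h * limit_moment l t n\<bar>
          \<le> real (n + 1) * K * h\<^sup>2"
        using h by (simp add: abs_mult power2_eq_square mult_ac flip: right_diff_distrib)
      have 4: "\<bar>chain_moment l m k (n + 2) - limit_moment l t (n + 2)\<bar> \<le> real k * (A * h\<^sup>2)"
        using Suc by (simp add: t_def)
      have "A * h\<^sup>2 = C * h\<^sup>2 + D * h\<^sup>2 + real (n + 1) * K * h\<^sup>2"
        by (simp add: A_def algebra_simps)
      moreover have "real (Suc k) * (A * h\<^sup>2) = real k * (A * h\<^sup>2) + A * h\<^sup>2"
        by (simp add: algebra_simps)
      ultimately show ?case
        unfolding th(3) using 1 2 3 4 by linarith
    qed
    also have "real k * (A * h\<^sup>2) = (real k * h) * (A * h)"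
      by (simp add: power2_eq_square)
    also have "\<dots> \<le> 1 * (A * h)"
      using that h \<open>A \<ge> 0\<close> by (intro mult_right_mono) (auto simp: h_def)
    finally show ?thesis by (simp add: h_def)
  qed
  then show ?case using \<open>A \<ge> 0\<close> by (intro exI[of _ A]) (simp only: add_2_eq_Suc', blast)
qed

lemma chain_moment_limit: "(\<lambda>m. chain_moment l m m n) \<longlonglongrightarrow> limit_moment l 1 n"
proof -
  obtain K where K: "\<And>m k. m > 0 \<Longrightarrow> k \<le> m \<Longrightarrow>
      \<bar>chain_moment l m k n - limit_moment l (real k / real m) n\<bar> \<le> K / real m"
    using chain_moment_converges by metis
  have "(\<lambda>m. chain_moment l m m n - limit_moment l 1 n) \<longlonglongrightarrow> 0"
  proof (rule Lim_null_comparison)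
    show "\<forall>\<^sub>F m in sequentially. norm (chain_moment l m m n - limit_moment l 1 n) \<le> K / real m"
      using eventually_gt_at_top[of 0]
    proof eventually_elim
      case (elim m)
      then show ?case using K[of m m] by simp
    qed
    show "(\<lambda>m. K / real m) \<longlonglongrightarrow> 0" by (rule lim_const_over_n)
  qed
  then show ?thesis by (simp add: LIM_zero_iff)
qed


section \<open>Moments of the limit distribution\<close>

definition semicircle :: "real \<Rightarrow> real" where "semicircle u = sqrt (2 - u\<^sup>2)"

lemma square_le_2: "u \<in> {- sqrt 2..sqrt 2} \<Longrightarrow> u\<^sup>2 \<le> 2"
  using abs_le_square_iff[of u "sqrt 2"] by auto

lemma square_less_2: "u \<in> {- sqrt 2<..<sqrt 2} \<Longrightarrow> u\<^sup>2 < 2"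
  using abs_square_less_1[of "u / sqrt 2"] by (auto simp: power_divide abs_less_iff field_simps)

lemma semicircle_pos: "u \<in> {- sqrt 2<..<sqrt 2} \<Longrightarrow> semicircle u > 0"
  using square_less_2 by (simp add: semicircle_def)

lemma semicircle_square: "u \<in> {- sqrt 2..sqrt 2} \<Longrightarrow> (semicircle u)\<^sup>2 = 2 - u\<^sup>2"
  using square_le_2 by (simp add: semicircle_def)

lemma semicircle_deriv:
  assumes "u \<in> {- sqrt 2<..<sqrt 2}"
  shows "(semicircle has_real_derivative (- u / semicircle u)) (at u)"
proof -
  have "((\<lambda>u. sqrt (2 - u\<^sup>2)) has_real_derivative (- u / sqrt (2 - u\<^sup>2))) (at u)"
    using square_less_2[OF assms] by (auto intro!: derivative_eq_intros simp: divide_simps)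
  then show ?thesis by (simp add: semicircle_def[abs_def])
qed

lemma continuous_semicircle [continuous_intros]: "continuous_on A semicircle"
  unfolding semicircle_def[abs_def] by (intro continuous_intros)

lemma arcsin_scaled_deriv:
  assumes "u \<in> {- sqrt 2<..<sqrt 2}"
  shows "((\<lambda>u. arcsin (u / sqrt 2)) has_real_derivative (1 / semicircle u)) (at u)"
proof -
  have 1: "- 1 < u / sqrt 2" "u / sqrt 2 < 1"
    using assms by (auto simp: field_simps)
  have "((\<lambda>u. arcsin (u / sqrt 2)) has_real_derivative
      inverse (sqrt (1 - (u / sqrt 2)\<^sup>2)) * (1 / sqrt 2)) (at u)"
    by (rule DERIV_chain2[where f = arcsin and g = "\<lambda>u. u / sqrt 2" and x = u, OF DERIV_arcsin[OF 1]])
       (intro DERIV_cdivide DERIV_ident)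
  moreover have "inverse (sqrt (1 - (u / sqrt 2)\<^sup>2)) * (1 / sqrt 2) = 1 / semicircle u"
  proof -
    have "semicircle u = sqrt (2 * (1 - (u / sqrt 2)\<^sup>2))"
      by (simp add: semicircle_def power_divide)
    then show ?thesis
      by (simp only: real_sqrt_mult inverse_eq_divide times_divide_times_eq mult_1 mult.commute)
  qed
  ultimately show ?thesis by simp
qed

lemma integral_odd:
  fixes f :: "real \<Rightarrow> real"
  assumes "\<And>u. f (- u) = - f u"
  shows "integral {- a..a} f = 0"
proof -
  have "integral {- a..a} f = integral {- a..a} (\<lambda>u. f (- u))"
    using Henstock_Kurzweil_Integration.integral_reflect_real[of a "- a" f] by (simp only: minus_minus)
  also have "\<dots> = - integral {- a..a} f"
    by (simp only: assms Henstock_Kurzweil_Integration.integral_neg)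
  finally show ?thesis by simp
qed

text \<open>
  The recursion comes from integrating the derivative of \<open>u\<^bsup>n+1\<^esup> (2 - u\<^sup>2)\<^bsup>3/2\<^esup>\<close>, a function that vanishes
  at both ends of the interval.
\<close>

lemma disc_integral:
  "integral {- sqrt 2..sqrt 2} (\<lambda>u. u ^ n * semicircle u / pi) = disc_moment n"
proof (induction n rule: disc_moment.induct)
  case 1
  have "((\<lambda>u. u ^ 0 * semicircle u / pi) has_integral
      (sqrt 2 * semicircle (sqrt 2) / 2 + arcsin (sqrt 2 / sqrt 2)) / pi -
      (- sqrt 2 * semicircle (- sqrt 2) / 2 + arcsin (- sqrt 2 / sqrt 2)) / pi) {- sqrt 2..sqrt 2}"
  proof (rule fundamental_theorem_of_calculus_interior)
    show "continuous_on {- sqrt 2..sqrt 2} (\<lambda>u. (u * semicircle u / 2 + arcsin (u / sqrt 2)) / pi)"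
      by (intro continuous_intros) (auto simp: field_simps)
    fix u assume u: "u \<in> {- sqrt 2<..<sqrt 2}"
    have "((\<lambda>u. (u * semicircle u / 2 + arcsin (u / sqrt 2)) / pi) has_real_derivative
        ((1 * semicircle u + (- u / semicircle u) * u) / 2 + 1 / semicircle u) / pi) (at u)"
      by (intro DERIV_cdivide DERIV_add DERIV_mult DERIV_ident semicircle_deriv arcsin_scaled_deriv u)
    moreover have "(1 * semicircle u + (- u / semicircle u) * u) / 2 + 1 / semicircle u = semicircle u"
      using semicircle_pos[OF u] semicircle_square[of u] u by (simp add: field_simps power2_eq_square)
    ultimately show "((\<lambda>u. (u * semicircle u / 2 + arcsin (u / sqrt 2)) / pi) has_vector_derivative
        u ^ 0 * semicircle u / pi) (at u)"
      by (simp add: has_real_derivative_iff_has_vector_derivative)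
  qed simp
  then have "integral {- sqrt 2..sqrt 2} (\<lambda>u. u ^ 0 * semicircle u / pi) =
      (sqrt 2 * semicircle (sqrt 2) / 2 + arcsin (sqrt 2 / sqrt 2)) / pi -
      (- sqrt 2 * semicircle (- sqrt 2) / 2 + arcsin (- sqrt 2 / sqrt 2)) / pi"
    by (rule integral_unique)
  also have "\<dots> = 1" by (simp add: semicircle_def field_simps)
  finally show ?case by (simp only: disc_moment.simps)
next
  case 2
  have "integral {- sqrt 2..sqrt 2} (\<lambda>u. u ^ Suc 0 * semicircle u / pi) = 0"
    by (rule integral_odd) (simp add: semicircle_def)
  then show ?case by (simp only: disc_moment.simps)
next
  case (3 n)
  define J where "J k = integral {- sqrt 2..sqrt 2} (\<lambda>u. u ^ k * semicircle u / pi)" for k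
  have intg: "(\<lambda>u. u ^ k * semicircle u / pi) integrable_on {- sqrt 2..sqrt 2}" for k
    by (intro integrable_continuous_interval continuous_intros) auto
  have "((\<lambda>u. real (2 * (n + 1)) * (u ^ n * semicircle u / pi) - real (n + 4) * (u ^ (n + 2) * semicircle u / pi)) has_integral
      sqrt 2 ^ (n + 1) * (2 - (sqrt 2)\<^sup>2) * semicircle (sqrt 2) / pi -
      (- sqrt 2) ^ (n + 1) * (2 - (- sqrt 2)\<^sup>2) * semicircle (- sqrt 2) / pi) {- sqrt 2..sqrt 2}"
  proof (rule fundamental_theorem_of_calculus_interior)
    show "continuous_on {- sqrt 2..sqrt 2} (\<lambda>u. u ^ (n + 1) * (2 - u\<^sup>2) * semicircle u / pi)"
      by (intro continuous_intros) auto
    fix u assume u: "u \<in> {- sqrt 2<..<sqrt 2}"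
    have "((\<lambda>u. u ^ (n + 1) * (2 - u\<^sup>2)) has_real_derivative
        real (n + 1) * u ^ n * (2 - u\<^sup>2) + (- (2 * u)) * u ^ (n + 1)) (at u)"
    proof (rule DERIV_mult)
      show "((\<lambda>u. u ^ (n + 1)) has_real_derivative real (n + 1) * u ^ n) (at u)"
        using DERIV_pow[of "n + 1" u] by simp
      show "((\<lambda>u. 2 - u\<^sup>2) has_real_derivative - (2 * u)) (at u)"
        by (auto intro!: derivative_eq_intros)
    qed
    from DERIV_cdivide[OF DERIV_mult[OF this semicircle_deriv[OF u]], of pi]
    have "((\<lambda>u. u ^ (n + 1) * (2 - u\<^sup>2) * semicircle u / pi) has_real_derivative
        ((real (n + 1) * u ^ n * (2 - u\<^sup>2) + (- (2 * u)) * u ^ (n + 1)) * semicircle u +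
         (- u / semicircle u) * (u ^ (n + 1) * (2 - u\<^sup>2))) / pi) (at u)"
      .
    moreover have h: "(- u / semicircle u) * (u ^ (n + 1) * (2 - u\<^sup>2)) = - (u ^ (n + 2) * semicircle u)"
    proof -
      have "2 - u\<^sup>2 = semicircle u * semicircle u" using semicircle_square[of u] u by (simp add: power2_eq_square)
      then show ?thesis using semicircle_pos[OF u] by simp
    qed
    have "((real (n + 1) * u ^ n * (2 - u\<^sup>2) + (- (2 * u)) * u ^ (n + 1)) * semicircle u +
         (- u / semicircle u) * (u ^ (n + 1) * (2 - u\<^sup>2))) / pi =
       real (2 * (n + 1)) * (u ^ n * semicircle u / pi) - real (n + 4) * (u ^ (n + 2) * semicircle u / pi)"
      unfolding h by (simp add: algebra_simps power2_eq_square add_divide_distrib diff_divide_distrib)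
    ultimately show "((\<lambda>u. u ^ (n + 1) * (2 - u\<^sup>2) * semicircle u / pi) has_vector_derivative
       real (2 * (n + 1)) * (u ^ n * semicircle u / pi) - real (n + 4) * (u ^ (n + 2) * semicircle u / pi)) (at u)"
      by (simp only: has_real_derivative_iff_has_vector_derivative)
  qed simp
  then have ftc: "((\<lambda>u. real (2 * (n + 1)) * (u ^ n * semicircle u / pi) - real (n + 4) * (u ^ (n + 2) * semicircle u / pi)) has_integral 0)
      {- sqrt 2..sqrt 2}"
    by (simp only: real_sqrt_pow2 power2_minus) simp
  have "((\<lambda>u. real (2 * (n + 1)) * (u ^ n * semicircle u / pi) - real (n + 4) * (u ^ (n + 2) * semicircle u / pi)) has_integral
      real (2 * (n + 1)) * J n - real (n + 4) * J (n + 2)) {- sqrt 2..sqrt 2}"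
    unfolding J_def by (intro has_integral_diff has_integral_mult_right integrable_integral intg)
  then have "real (2 * (n + 1)) * J n - real (n + 4) * J (n + 2) = 0"
    using ftc by (rule has_integral_unique)
  then have "J (n + 2) = 2 * real (n + 1) / real (n + 4) * J n"
    by (simp add: field_simps)
  then show ?case using 3 by (simp only: J_def add_2_eq_Suc' disc_moment.simps)
qed

text \<open>
  The density of \<open>nu_ac l\<close> in the variable \<open>u = x - l\<close>. For \<open>l > 0\<close> it is continuous on the closed interval
  \<open>[-\<surd>2, \<surd>2]\<close> since the denominator is at least \<open>\<pi> l\<^sup>2\<close>.
\<close>

definition ac_density :: "real \<Rightarrow> real \<Rightarrow> real"
  where "ac_density l u = semicircle u / (pi * (l\<^sup>2 + 2 - u\<^sup>2))"

lemma ac_denominator_pos: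
  "l > 0 \<Longrightarrow> u \<in> {- sqrt 2..sqrt 2} \<Longrightarrow> l\<^sup>2 + 2 - u\<^sup>2 > 0"
  using square_le_2[of u] by (smt (verit) zero_less_power)

lemma continuous_ac_density:
  assumes "l > 0"
  shows "continuous_on {- sqrt 2..sqrt 2} (ac_density l)"
  unfolding ac_density_def[abs_def]
  using ac_denominator_pos[OF assms]
  by (intro continuous_intros) force

text \<open>
  Up to the factor \<open>1 / \<pi>\<close>, the substitution \<open>u = \<surd>2 sin \<theta>\<close> produces the antiderivative
  \<open>arcsin (u / \<surd>2) - q arctan (q u / \<surd>(2 - u\<^sup>2))\<close>. Rewriting the second term by
  \<open>arctan y = arcsin (y / \<surd>(1 + y\<^sup>2))\<close> gives the function \<open>G\<close>, which extends continuously to the end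
  points, so the fundamental theorem of calculus applies on the closed interval.
\<close>

lemma ac_mass:
  assumes l: "l > 0"
  shows "integral {- sqrt 2..sqrt 2} (ac_density l) = 1 - l / sqrt (l\<^sup>2 + 2)"
proof -
  \<comment> \<open>\<open>q\<close> is the mass of the atom, and \<open>g\<close> runs from \<open>-1\<close> to \<open>1\<close> on the interval.\<close>
  define q where "q = l / sqrt (l\<^sup>2 + 2)"
  define g where "g u = l * u / (sqrt 2 * sqrt (l\<^sup>2 + 2 - u\<^sup>2))" for u
  define G where "G u = (arcsin (u / sqrt 2) - q * arcsin (g u)) / pi" for u
  have pos: "l\<^sup>2 + 2 - u\<^sup>2 > 0" if "u \<in> {- sqrt 2..sqrt 2}" for u
    using ac_denominator_pos[OF l that] .
  have g2: "1 - (g u)\<^sup>2 = (l\<^sup>2 + 2) * (2 - u\<^sup>2) / (2 * (l\<^sup>2 + 2 - u\<^sup>2))" if "u \<in> {- sqrt 2..sqrt 2}" for u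
    using pos[OF that] by (simp add: g_def power_divide power_mult_distrib field_simps power2_eq_square)
  have g_le: "\<bar>g u\<bar> \<le> 1" if "u \<in> {- sqrt 2..sqrt 2}" for u
  proof -
    have "1 - (g u)\<^sup>2 \<ge> 0"
      unfolding g2[OF that] using pos[OF that] square_le_2[OF that] by simp
    then show ?thesis by (simp add: abs_square_le_1)
  qed
  have gc: "continuous_on {- sqrt 2..sqrt 2} g"
    unfolding g_def using pos by (intro continuous_intros) force
  have "(ac_density l has_integral G (sqrt 2) - G (- sqrt 2)) {- sqrt 2..sqrt 2}"
  proof (rule fundamental_theorem_of_calculus_interior)
    show "continuous_on {- sqrt 2..sqrt 2} G"
      unfolding G_def using g_le
      by (intro continuous_intros gc) (auto simp: field_simps abs_le_iff)
    fix u assume u: "u \<in> {- sqrt 2<..<sqrt 2}"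
    define \<tau> where "\<tau> = sqrt (l\<^sup>2 + 2 - u\<^sup>2)"
    have u': "u \<in> {- sqrt 2..sqrt 2}" using u by auto
    have \<tau>: "\<tau> > 0" "\<tau>\<^sup>2 = l\<^sup>2 + 2 - u\<^sup>2" using pos[OF u'] by (simp_all add: \<tau>_def)
    have \<sigma>: "semicircle u > 0" using semicircle_pos[OF u] .
    have lp: "l\<^sup>2 + 2 > 0" by (smt (verit) zero_le_power2)
    have "1 - (g u)\<^sup>2 > 0"
      unfolding g2[OF u'] using pos[OF u'] square_less_2[OF u] lp by simp
    then have g1: "- 1 < g u" "g u < 1"
      by (auto simp: abs_square_less_1 abs_less_iff)
    have "((\<lambda>u. sqrt (l\<^sup>2 + 2 - u\<^sup>2)) has_real_derivative (- u / \<tau>)) (at u)"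
      using pos[OF u'] unfolding \<tau>_def by (auto intro!: derivative_eq_intros simp: divide_simps)
    then have 1: "((\<lambda>u. sqrt 2 * sqrt (l\<^sup>2 + 2 - u\<^sup>2)) has_real_derivative (sqrt 2 * (- u / \<tau>))) (at u)"
      by (rule DERIV_cmult)
    have 2: "((\<lambda>u. l * u) has_real_derivative l) (at u)"
      by (rule DERIV_cmult_Id)
    have "sqrt 2 * sqrt (l\<^sup>2 + 2 - u\<^sup>2) \<noteq> 0" using \<tau>(1) by (simp add: \<tau>_def)
    from DERIV_divide[OF 2 1 this]
    have gd: "(g has_real_derivative
        (l * (sqrt 2 * \<tau>) - l * u * (sqrt 2 * (- u / \<tau>))) / (sqrt 2 * \<tau> * (sqrt 2 * \<tau>))) (at u)"
      unfolding g_def[abs_def] by (simp only: \<tau>_def[symmetric])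
    have "l * (sqrt 2 * \<tau>) - l * u * (sqrt 2 * (- u / \<tau>)) = sqrt 2 * l * (\<tau>\<^sup>2 + u\<^sup>2) / \<tau>"
      using \<tau>(1) by (simp add: field_simps power2_eq_square)
    also have "\<tau>\<^sup>2 + u\<^sup>2 = l\<^sup>2 + 2" by (simp add: \<tau>)
    finally have num: "(l * (sqrt 2 * \<tau>) - l * u * (sqrt 2 * (- u / \<tau>))) / (sqrt 2 * \<tau> * (sqrt 2 * \<tau>))
        = l * (l\<^sup>2 + 2) / (sqrt 2 * \<tau> ^ 3)"
      using \<tau>(1) by (simp add: field_simps power3_eq_cube)
    have "sqrt (1 - (g u)\<^sup>2) = sqrt (l\<^sup>2 + 2) * semicircle u / (sqrt 2 * \<tau>)"
      unfolding g2[OF u'] by (simp only: real_sqrt_mult real_sqrt_divide semicircle_def \<tau>_def)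
    then have "((\<lambda>u. arcsin (g u)) has_real_derivative
        inverse (sqrt (l\<^sup>2 + 2) * semicircle u / (sqrt 2 * \<tau>)) * (l * (l\<^sup>2 + 2) / (sqrt 2 * \<tau> ^ 3))) (at u)"
      using DERIV_chain2[where f = arcsin and g = g and x = u, OF DERIV_arcsin[OF g1] gd]
      by (simp only: num)
    moreover have "inverse (sqrt (l\<^sup>2 + 2) * semicircle u / (sqrt 2 * \<tau>)) * (l * (l\<^sup>2 + 2) / (sqrt 2 * \<tau> ^ 3))
        = l * sqrt (l\<^sup>2 + 2) / (\<tau>\<^sup>2 * semicircle u)"
    proof -
      have *: "l\<^sup>2 + 2 = sqrt (l\<^sup>2 + 2) * sqrt (l\<^sup>2 + 2)" "sqrt (l\<^sup>2 + 2) > 0"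
        using lp by simp_all
      show ?thesis
        using \<tau>(1) \<sigma> *(2) by (subst (2) *(1)) (simp add: field_simps power2_eq_square power3_eq_cube)
    qed
    ultimately have "((\<lambda>u. arcsin (g u)) has_real_derivative l * sqrt (l\<^sup>2 + 2) / (\<tau>\<^sup>2 * semicircle u)) (at u)"
      by simp
    then have "(G has_real_derivative
        (1 / semicircle u - q * (l * sqrt (l\<^sup>2 + 2) / (\<tau>\<^sup>2 * semicircle u))) / pi) (at u)"
      unfolding G_def by (intro DERIV_cdivide DERIV_diff DERIV_cmult arcsin_scaled_deriv u)
    moreover have "(1 / semicircle u - q * (l * sqrt (l\<^sup>2 + 2) / (\<tau>\<^sup>2 * semicircle u))) / pi = ac_density l u"
    proof -
      have e1: "q * (l * sqrt (l\<^sup>2 + 2) / (\<tau>\<^sup>2 * semicircle u)) = l\<^sup>2 / (\<tau>\<^sup>2 * semicircle u)"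
        using lp by (simp add: q_def power2_eq_square)
      have e2: "1 / semicircle u - l\<^sup>2 / (\<tau>\<^sup>2 * semicircle u) = (\<tau>\<^sup>2 - l\<^sup>2) / (\<tau>\<^sup>2 * semicircle u)"
        using \<tau>(1) \<sigma> by (simp add: field_simps)
      have e3: "\<tau>\<^sup>2 - l\<^sup>2 = semicircle u * semicircle u"
        using semicircle_square[OF u'] \<tau>(2) by (simp add: power2_eq_square)
      show ?thesis
        unfolding e1 e2 e3 using \<sigma> by (simp add: ac_density_def \<tau>(2) mult.commute)
    qed
    ultimately show "(G has_vector_derivative ac_density l u) (at u)"
      by (simp add: has_real_derivative_iff_has_vector_derivative)
  qed simp
  moreover have "g (sqrt 2) = 1" "g (- sqrt 2) = - 1"
    using l by (simp_all add: g_def)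
  ultimately show ?thesis
    by (simp add: integral_unique G_def q_def field_simps)
qed

text \<open>
  The left side is the \<open>n\<close>-th centred moment of \<open>nu l\<close>. Multiplication by \<open>l\<^sup>2 + 2 - u\<^sup>2\<close> cancels the
  denominator of the density and kills the atom at \<open>u = - \<surd>(l\<^sup>2 + 2)\<close>, which yields the recursion of
  \<^const>\<open>limit_moment\<close>; total mass and mean start it.
\<close>

lemma ac_central_moment:
  assumes l: "l > 0"
  shows "l / sqrt (l\<^sup>2 + 2) * (- sqrt (l\<^sup>2 + 2)) ^ n +
    integral {- sqrt 2..sqrt 2} (\<lambda>u. ac_density l u * u ^ n) = limit_moment l 1 n"
proof (induction n rule: disc_moment.induct)
  case 1
  show ?case by (simp add: ac_mass[OF l])
next
  case 2
  have "integral {- sqrt 2..sqrt 2} (\<lambda>u. ac_density l u * u) = 0"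
    by (rule integral_odd) (simp add: ac_density_def semicircle_def)
  moreover have "sqrt (l\<^sup>2 + 2) > 0" using l by (simp add: add_nonneg_pos)
  ultimately show ?case by simp
next
  case (3 n)
  have "integral {- sqrt 2..sqrt 2} (\<lambda>u. ac_density l u * u ^ Suc (Suc n)) =
      integral {- sqrt 2..sqrt 2} (\<lambda>u. (l\<^sup>2 + 2) * (ac_density l u * u ^ n) - u ^ n * semicircle u / pi)"
  proof (rule Henstock_Kurzweil_Integration.integral_cong)
    fix u assume "u \<in> {- sqrt 2..sqrt 2}"
    then have "l\<^sup>2 + 2 - u\<^sup>2 > 0" using ac_denominator_pos[OF l] by blast
    then have "(l\<^sup>2 + 2 - u\<^sup>2) * ac_density l u = semicircle u / pi"
      by (simp add: ac_density_def)
    then have "(l\<^sup>2 + 2 - u\<^sup>2) * ac_density l u * u ^ n = u ^ n * semicircle u / pi" by simp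
    then show "ac_density l u * u ^ Suc (Suc n) = (l\<^sup>2 + 2) * (ac_density l u * u ^ n) - u ^ n * semicircle u / pi"
      by (simp add: algebra_simps power2_eq_square)
  qed
  also have "\<dots> = (l\<^sup>2 + 2) * integral {- sqrt 2..sqrt 2} (\<lambda>u. ac_density l u * u ^ n) - disc_moment n"
    unfolding disc_integral[symmetric]
    by (subst Henstock_Kurzweil_Integration.integral_diff)
       (auto intro!: integrable_continuous_interval continuous_intros continuous_ac_density[OF l])
  finally have I: "integral {- sqrt 2..sqrt 2} (\<lambda>u. ac_density l u * u ^ Suc (Suc n)) =
    (l\<^sup>2 + 2) * integral {- sqrt 2..sqrt 2} (\<lambda>u. ac_density l u * u ^ n) - disc_moment n" .
  have sq: "(- sqrt (l\<^sup>2 + 2)) ^ Suc (Suc n) = (l\<^sup>2 + 2) * (- sqrt (l\<^sup>2 + 2)) ^ n"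
    by simp
  show ?case
    unfolding I sq limit_moment.simps 3[symmetric] by (simp add: algebra_simps add_divide_distrib)
qed

text \<open>
  The density vanishes at the end points, so the open interval may be replaced by the closed one.
\<close>

lemma nu_ac_eq: "nu_ac l = density lborel
    (\<lambda>x. ennreal (ac_density l (x - l) * indicator {- sqrt 2..sqrt 2} (x - l)))"
proof -
  have "sqrt (2 - (x - l)\<^sup>2) / (pi * (l\<^sup>2 + 2 - (x - l)\<^sup>2)) *
      indicator {l - sqrt 2<..<l + sqrt 2} x =
    ac_density l (x - l) * indicator {- sqrt 2..sqrt 2} (x - l)" for x
    by (cases "x - l = sqrt 2 \<or> x - l = - sqrt 2")
       (auto simp: ac_density_def semicircle_def indicator_def)
  then show ?thesis by (simp add: nu_ac_def)
qed

lemma measurable_ac_density [measurable]: "ac_density l \<in> borel_measurable borel"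
  unfolding ac_density_def[abs_def] semicircle_def by measurable

lemma ac_density_nonneg:
  assumes "l > 0"
  shows "0 \<le> ac_density l u * indicator {- sqrt 2..sqrt 2} u"
  using ac_denominator_pos[OF assms, of u] square_le_2[of u]
  by (auto simp: indicator_def ac_density_def semicircle_def)

lemma ac_has_integral:
  assumes l: "l > 0"
  shows "integrable lborel (\<lambda>u. ac_density l u * indicator {- sqrt 2..sqrt 2} u * u ^ n)"
    and "(\<integral>u. ac_density l u * indicator {- sqrt 2..sqrt 2} u * u ^ n \<partial>lborel) =
      integral {- sqrt 2..sqrt 2} (\<lambda>u. ac_density l u * u ^ n)"
proof -
  have eq: "(\<lambda>u. ac_density l u * indicator {- sqrt 2..sqrt 2} u * u ^ n) =
      (\<lambda>u. indicator {- sqrt 2..sqrt 2} u *\<^sub>R (ac_density l u * u ^ n))"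
    by (auto simp: indicator_def)
  have "continuous_on {- sqrt 2..sqrt 2} (\<lambda>u. ac_density l u * u ^ n)"
    by (intro continuous_intros continuous_ac_density[OF l])
  then have *: "set_integrable lborel {- sqrt 2..sqrt 2} (\<lambda>u. ac_density l u * u ^ n)"
    by (rule borel_integrable_atLeastAtMost')
  then show "integrable lborel (\<lambda>u. ac_density l u * indicator {- sqrt 2..sqrt 2} u * u ^ n)"
    unfolding eq set_integrable_def .
  show "(\<integral>u. ac_density l u * indicator {- sqrt 2..sqrt 2} u * u ^ n \<partial>lborel) =
      integral {- sqrt 2..sqrt 2} (\<lambda>u. ac_density l u * u ^ n)"
    using set_borel_integral_eq_integral(2)[OF *] unfolding eq set_lebesgue_integral_def .
qed

lemma integral_nu_ac:
  assumes l: "l > 0"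
  shows "(\<integral>x. (x - l) ^ n \<partial>nu_ac l) = integral {- sqrt 2..sqrt 2} (\<lambda>u. ac_density l u * u ^ n)"
proof -
  have "(\<integral>x. (x - l) ^ n \<partial>nu_ac l) =
      (\<integral>x. (ac_density l (x - l) * indicator {- sqrt 2..sqrt 2} (x - l)) *\<^sub>R (x - l) ^ n \<partial>lborel)"
    unfolding nu_ac_eq using ac_density_nonneg[OF l] by (intro integral_density) auto
  also have "\<dots> = (\<integral>u. ac_density l u * indicator {- sqrt 2..sqrt 2} u * u ^ n \<partial>lborel)"
    using lborel_integral_real_affine[of 1
        "\<lambda>u. ac_density l u * indicator {- sqrt 2..sqrt 2} u * u ^ n" "- l"]
    by simp
  finally show ?thesis by (simp only: ac_has_integral(2)[OF l])
qed

lemma emeasure_nu_ac_UNIV: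
  assumes l: "l > 0"
  shows "emeasure (nu_ac l) UNIV = ennreal (1 - l / sqrt (l\<^sup>2 + 2))"
proof -
  define f where "f u = ac_density l u * indicator {- sqrt 2..sqrt 2} u" for u
  have [measurable]: "f \<in> borel_measurable borel" unfolding f_def by measurable
  have "emeasure (nu_ac l) UNIV = (\<integral>\<^sup>+x. ennreal (f (x - l)) \<partial>lborel)"
    unfolding nu_ac_eq f_def by (subst emeasure_density) auto
  also have "\<dots> = (\<integral>\<^sup>+u. ennreal (f u) \<partial>lborel)"
    using nn_integral_real_affine[of "\<lambda>u. ennreal (f u)" 1 "- l"] by simp
  also have "\<dots> = ennreal (\<integral>u. f u \<partial>lborel)"
    using ac_has_integral(1)[OF l, of 0] ac_density_nonneg[OF l]
    by (intro nn_integral_eq_integral) (simp_all add: f_def)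
  also have "(\<integral>u. f u \<partial>lborel) = 1 - l / sqrt (l\<^sup>2 + 2)"
    using ac_has_integral(2)[OF l, of 0] ac_mass[OF l] by (simp add: f_def)
  finally show ?thesis .
qed

lemma real_distribution_nu:
  assumes l: "l > 0"
  shows "real_distribution (nu l)"
proof -
  have "l \<le> sqrt (l\<^sup>2 + 2)" by (rule real_le_rsqrt) simp
  then have "l / sqrt (l\<^sup>2 + 2) \<le> 1"
    by (simp add: divide_le_eq_1 add_nonneg_pos)
  then have "emeasure (nu l) UNIV = 1"
    using l by (simp add: emeasure_nu emeasure_nu_ac_UNIV flip: ennreal_plus)
  then have "prob_space (nu l)" by (intro prob_spaceI) simp
  then show ?thesis
    by (simp add: real_distribution_def real_distribution_axioms_def)
qed

lemma nu_bounded: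
  assumes l: "l > 0"
  shows "AE x in nu l. \<bar>x - l\<bar> \<le> sqrt (l\<^sup>2 + 2)"
proof (rule AE_I)
  let ?A = "{x. \<not> \<bar>x - l\<bar> \<le> sqrt (l\<^sup>2 + 2)}"
  show A: "?A \<in> sets (nu l)" by simp
  then have Ab: "?A \<in> sets borel" by simp
  have "emeasure (nu_ac l) ?A = (\<integral>\<^sup>+x. ennreal (ac_density l (x - l) * indicator {- sqrt 2..sqrt 2} (x - l))
      * indicator ?A x \<partial>lborel)"
    unfolding nu_ac_eq using Ab by (intro emeasure_density) auto
  also have "\<dots> = (\<integral>\<^sup>+(x :: real). 0 \<partial>lborel)"
  proof (rule nn_integral_cong)
    fix x
    have "sqrt 2 \<le> sqrt (l\<^sup>2 + 2)" by simp
    then have "x - l \<notin> {- sqrt 2..sqrt 2} \<or> x \<notin> ?A"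
      unfolding atLeastAtMost_iff mem_Collect_eq by linarith
    then show "ennreal (ac_density l (x - l) * indicator {- sqrt 2..sqrt 2} (x - l)) * indicator ?A x = 0"
      by auto
  qed
  finally show "emeasure (nu l) ?A = 0"
    using Ab by (simp add: emeasure_nu)
qed auto

text \<open>
  The atom is invisible to \<open>nu_ac l\<close>, so the two parts of \<open>nu l\<close> are its restrictions to the
  atom and to the complement of the atom, and the integral splits accordingly.
\<close>

lemma integral_nu:
  assumes l: "l > 0" and f: "integrable (nu l) f"
  shows "(\<integral>x. f x \<partial>nu l) =
    l / sqrt (l\<^sup>2 + 2) * f (l - sqrt (l\<^sup>2 + 2)) + (\<integral>x. f x \<partial>nu_ac l)"
proof -
  define y where "y = l - sqrt (l\<^sup>2 + 2)"
  have null: "{y} \<in> null_sets (nu_ac l)"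
  proof -
    have "absolutely_continuous lborel (nu_ac l)"
      unfolding nu_ac_def by (rule absolutely_continuousI_density) measurable
    moreover have "{y} \<in> null_sets lborel" by (simp add: null_sets_def)
    ultimately show ?thesis unfolding absolutely_continuous_def by blast
  qed
  have atom: "measure (nu l) {y} = l / sqrt (l\<^sup>2 + 2)"
    using l null by (simp add: measure_def emeasure_nu y_def null_sets_def)
  have fm: "f \<in> borel_measurable (nu l)" using f by auto
  have rest: "density (nu l) (\<lambda>x. ennreal (indicator (- {y}) x)) = nu_ac l"
  proof (rule measure_eqI)
    show "sets (density (nu l) (\<lambda>x. ennreal (indicator (- {y}) x))) = sets (nu_ac l)"
      by (simp add: nu_ac_def)
    fix X assume "X \<in> sets (density (nu l) (\<lambda>x. ennreal (indicator (- {y}) x)))"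
    then have X: "X \<in> sets borel" by simp
    have "emeasure (density (nu l) (indicator (- {y}))) X = emeasure (nu l) (- {y} \<inter> X)"
      using X by (intro emeasure_restricted) auto
    also have "\<dots> = emeasure (nu_ac l) (X - {y})"
      using X by (simp add: emeasure_nu y_def Diff_eq Int_commute)
    also have "\<dots> = emeasure (nu_ac l) X"
      using X null by (intro emeasure_Diff_null_set) (auto simp: nu_ac_def)
    finally show "emeasure (density (nu l) (\<lambda>x. ennreal (indicator (- {y}) x))) X = emeasure (nu_ac l) X"
      by (simp add: ennreal_indicator)
  qed
  have iy: "integrable (nu l) (\<lambda>x. indicator {y} x *\<^sub>R f x)"
    and iny: "integrable (nu l) (\<lambda>x. indicator (- {y}) x *\<^sub>R f x)"
    by (intro integrable_mult_indicator f; simp)+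
  have "(\<integral>x. f x \<partial>nu l) = (\<integral>x. indicator {y} x *\<^sub>R f x + indicator (- {y}) x *\<^sub>R f x \<partial>nu l)"
    by (intro Bochner_Integration.integral_cong) (auto simp: indicator_def)
  also have "\<dots> = (\<integral>x. indicator {y} x *\<^sub>R f x \<partial>nu l) + (\<integral>x. indicator (- {y}) x *\<^sub>R f x \<partial>nu l)"
    by (rule Bochner_Integration.integral_add[OF iy iny])
  also have "(\<integral>x. indicator {y} x *\<^sub>R f x \<partial>nu l) = (\<integral>x. indicator {y} x * f y \<partial>nu l)"
    by (intro Bochner_Integration.integral_cong) (auto simp: indicator_def)
  also have "\<dots> = l / sqrt (l\<^sup>2 + 2) * f y"
    by (simp add: atom)
  also have "(\<integral>x. indicator (- {y}) x *\<^sub>R f x \<partial>nu l) = (\<integral>x. f x \<partial>nu_ac l)"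
    unfolding rest[symmetric] using fm by (intro integral_density[symmetric] borel_measurable_indicator) auto
  finally show ?thesis by (simp add: y_def)
qed

lemma nu_central_moment:
  assumes l: "l > 0"
  shows "(\<integral>x. (x - l) ^ n \<partial>nu l) = limit_moment l 1 n"
proof -
  have "(\<integral>x. (x - l) ^ n \<partial>nu l) =
      l / sqrt (l\<^sup>2 + 2) * (- sqrt (l\<^sup>2 + 2)) ^ n + (\<integral>x. (x - l) ^ n \<partial>nu_ac l)"
    by (subst integral_nu[OF l AE_bounded_moments(1)[OF real_distribution_nu[OF l] nu_bounded[OF l]]])
       simp
  then show ?thesis by (simp only: integral_nu_ac[OF l] ac_central_moment[OF l])
qed


section \<open>Convergence of the vacuum laws\<close>

definition chain_distribution :: "real \<Rightarrow> nat \<Rightarrow> real measure"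
  where "chain_distribution l m =
    distr (measure_pmf (chain_law (1 / sqrt (real m)) l m)) borel (\<lambda>x. x)"

lemma real_distribution_chain: "real_distribution (chain_distribution l m)"
  unfolding chain_distribution_def by (intro prob_space.real_distribution_distr) (auto intro: measure_pmf.prob_space_axioms)

lemma chain_distribution_bounded:
  "AE x in chain_distribution l m. \<bar>x - l\<bar> \<le> sqrt (l\<^sup>2 + 2)"
  unfolding chain_distribution_def
  by (subst AE_distr_iff) (auto simp: AE_measure_pmf_iff intro: chain_law_support_uniform[OF order_refl])

lemma integral_chain_distribution:
  "f \<in> borel_measurable borel \<Longrightarrow> (\<integral>x. f x \<partial>chain_distribution l m) =
    (measure_pmf.expectation (chain_law (1 / sqrt (real m)) l m) f :: real)"
  unfolding chain_distribution_def by (subst integral_distr) auto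

text \<open>
  Here \<open>s = 1 / \<surd>m\<close> and \<open>c = l \<surd>m\<close>, so the lower right entry \<open>s c\<close> of the block operator is \<open>l\<close>.
\<close>

lemma vacuum_law_poisson:
  assumes "full_fock_space tensor" and "monotone_operators tensor e a adag"
  shows "vacuum_law (tensor [])
      (\<lambda>x. (1 / sqrt (real m)) *\<^sub>R poisson_sum a adag m (l * sqrt (real m)) x) =
    chain_distribution l m"
proof (rule vacuum_law_eqI[OF real_distribution_chain chain_distribution_bounded])
  fix n
  interpret scaled_poisson e tensor a adag "1 / sqrt (real m)" "l * sqrt (real m)"
    using assms by unfold_locales
  have "cinner ((T m ^^ n) (tensor [])) (tensor []) = complex_of_real (measure_pmf.expectation
      (chain_law (1 / sqrt (real m)) (1 / sqrt (real m) * (l * sqrt (real m))) m) (\<lambda>x. x ^ n))"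
    by (rule vacuum_moments) auto
  also have "chain_law (1 / sqrt (real m)) (1 / sqrt (real m) * (l * sqrt (real m))) m =
      chain_law (1 / sqrt (real m)) l m"
    by (cases "m = 0") auto
  finally show "complex_of_real (\<integral>x. x ^ n \<partial>chain_distribution l m) =
      cinner (((\<lambda>x. (1 / sqrt (real m)) *\<^sub>R poisson_sum a adag m (l * sqrt (real m)) x) ^^ n)
        (tensor [])) (tensor [])"
    by (simp add: integral_chain_distribution T_def[abs_def])
qed

theorem theorem5p3:
  fixes e :: "nat \<Rightarrow> 'h::complex_hilbert"
    and tensor :: "'h list \<Rightarrow> 'f::complex_hilbert"
    and a adag :: "nat \<Rightarrow> 'f \<Rightarrow> 'f"
    and l :: real
  assumes "orthonormal_basis e"
    and "full_fock_space tensor"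
    and "monotone_operators tensor e a adag"
    and "l > 0"
  shows "real_distribution (nu l) \<and>
    weak_conv_m
      (\<lambda>m. vacuum_law (vacuum tensor)
        (\<lambda>x. (1 / sqrt (real m)) *\<^sub>R poisson_sum a adag m (l * sqrt (real m)) x))
      (nu l)"
proof
  show nu: "real_distribution (nu l)" using assms(4) by (rule real_distribution_nu)
  have "weak_conv_m (chain_distribution l) (nu l)"
  proof (rule weak_conv_of_central_moments[OF real_distribution_chain nu
        chain_distribution_bounded nu_bounded[OF assms(4)]])
    show "(\<lambda>m. \<integral>x. (x - l) ^ n \<partial>chain_distribution l m) \<longlonglongrightarrow> (\<integral>x. (x - l) ^ n \<partial>nu l)" for n
      using chain_moment_limit[of l n]
      by (simp add: integral_chain_distribution nu_central_moment[OF assms(4)] chain_moment_def)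
  qed
  then show "weak_conv_m
      (\<lambda>m. vacuum_law (vacuum tensor)
        (\<lambda>x. (1 / sqrt (real m)) *\<^sub>R poisson_sum a adag m (l * sqrt (real m)) x))
      (nu l)"
    unfolding vacuum_law_poisson[OF assms(2,3)] .
qed

end
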